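(* Let $A$ be a quasi-Hopf (super)algebra of trace type, with invertible even $u\in A$ satisfying $S^2(a)=uau^{-1}$ for all $a\in A$; let $V$ be a finite-dimensional graded $A$-module and $F$ a twistor. Let $\theta=\sum_ia_i\otimes b_i\otimes c_i\in A^{\otimes3}$ satisfy $(1\otimes\Delta)\Delta(a)\cdot\theta=\theta\cdot(1\otimes\Delta)\Delta(a)$ for all $a\in A$, and let $\bar\theta=\sum_i\bar a_i\otimes\bar b_i\otimes\bar c_i\in A^{\otimes3}$ satisfy $\bar\theta\cdot(\Delta\otimes1)\Delta(a)=(\Delta\otimes1)\Delta(a)\cdot\bar\theta$ for all $a\in A$. Define the (central) elements $$C=\sum_i\mathrm{Str}_V\big(uS^{-1}(\alpha)b_i\beta S(c_i)\big)a_i,\qquad \bar C=\sum_i\mathrm{Str}_V\big(u^{-1}S(\beta)S(\bar a_i)\alpha\bar b_i\big)\bar c_i .$$ Put $$\theta_F=(1\otimes F)\,(1\otimes\Delta)F\cdot\theta\cdot(1\otimes\Delta)F^{-1}\,(1\otimes F^{-1})=\sum_ia^F_i\otimes b^F_i\otimes c^F_i,$$ $$\bar\theta_F=(F\otimes1)\,(\Delta\otimes1)F\cdot\bar\theta\cdot(\Delta\otimes1)F^{-1}\,(F^{-1}\otimes1)=\sum_i\bar a^F_i\otimes\bar b^F_i\otimes\bar c^F_i,$$ $$C_F=\sum_i\mathrm{Str}_V\big(uS^{-1}(\alpha_F)b^F_i\beta_FS(c^F_i)\big)a^F_i,\qquad \bar C_F=\sum_i\mathrm{Str}_V\big(u^{-1}S(\beta_F)S(\bar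 a^F_i)\alpha_F\bar b^F_i\big)\bar c^F_i .$$ Then $C_F=C$ and $\bar C_F=\bar C$; that is, the trace type central elements are invariant under twisting.
   Context: A quasi-Hopf (super)algebra $(A,\Delta,\epsilon,\Phi)$ is a unital associative $\mathbb Z_2$-graded algebra $A$ over a field $K$ (the ungraded case being $A$ concentrated in degree $0$; $[a]\in\mathbb Z_2$ is the degree of a homogeneous $a$; sign formulas are stated for homogeneous elements and extended linearly), with grading-preserving algebra homomorphisms $\epsilon:A\to K$, $\Delta:A\to A\otimes A$, an invertible homogeneous $\Phi\in A\otimes A\otimes A$, a graded algebra anti-homomorphism $S:A\to A$ (grading preserving, $S(ab)=(-1)^{[a][b]}S(b)S(a)$) and homogeneous $\alpha,\beta\in A$; $S$ is assumed bijective. Tensor products are multiplied by $(a\otimes b)(a'\otimes b')=(-1)^{[b][a']}aa'\otimes bb'$. Write $\Phi=\sum_\nu X_\nu\otimes Y_\nu\otimes Z_\nu$, $\Phi^{-1}=\sum_\nu\bar X_\nu\otimes\bar Y_\nu\otimes\bar Z_\nu$, $\Delta(a)=\sum a_{(1)}\otimes a_{(2)}$ (homogeneous components). The axioms are, for all $a\in A$: $(1\otimes\Delta)\Delta(a)=\Phi^{-1}(\Delta\otimes1)\Delta(a)\Phi$; $(\Delta\otimes1\otimes1)\Phi\cdot(1\otimes1\otimes\Delta)\Phi=(\Phi\otimes1)\cdot(1\otimes\Delta\otimes1)\Phi\cdot(1\otimes\Phi)$; $(\epsilon\otimes1)\Delta=1=(1\otimes\epsilon)\Delta$; $(1\otimes\epsilon\otimes1)\Phi=1$;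 $\sum S(a_{(1)})\alpha a_{(2)}=\epsilon(a)\alpha$; $\sum a_{(1)}\beta S(a_{(2)})=\epsilon(a)\beta$; $\sum\bar X_\nu\beta S(\bar Y_\nu)\alpha\bar Z_\nu=1$; $\sum S(X_\nu)\alpha Y_\nu\beta S(Z_\nu)=1$. These imply that $\Phi,\alpha,\beta$ are even. $A$ is of trace type if there is an invertible even $u\in A$ with $S^2(a)=uau^{-1}$ for all $a\in A$. For $a\in A$, $\mathrm{Str}_V(a)$ is the supertrace over $V$ of the operator by which $a$ acts on $V$ (the ordinary trace in the ungraded case). A twistor is an invertible homogeneous $F\in A\otimes A$ with $(\epsilon\otimes1)F=1=(1\otimes\epsilon)F$ (it is then even). Write $F=\sum_i f_i\otimes f^i$, $F^{-1}=\sum_i\bar f_i\otimes\bar f^i$. The twisted quasi-Hopf (super)algebra structure on $A$ has the same $\epsilon$ and $S$, and $\Delta_F(a)=F\Delta(a)F^{-1}$, $\Phi_F=(F\otimes1)\,(\Delta\otimes1)F\cdot\Phi\cdot(1\otimes\Delta)F^{-1}\,(1\otimes F^{-1})$, $\alpha_F=\sum_iS(\bar f_i)\alpha\bar f^i$, $\beta_F=\sum_if_i\beta S(f^i)$. *)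

theory Defs
  imports Complex_Main "HOL-Library.Poly_Mapping" "HOL-Library.Z2"
begin

section \<open>Graded vector spaces and graded algebras\<close>

text \<open>The degree group is the two-element type \<open>bit\<close>; the ungraded case is \<open>homog V 1 = {0}\<close>.\<close>

record ('k, 'v) super_space =
  scal :: "'k \<Rightarrow> 'v \<Rightarrow> 'v"
  homog :: "bit \<Rightarrow> 'v set"

locale super_vector_space = vector_space "scal V"
  for V :: "('k::field, 'v::ab_group_add, 'z) super_space_scheme" +
  assumes subspace_homog: "subspace (homog V i)"
    and homog_Int: "homog V 0 \<inter> homog V 1 = {0}"
    and homog_sum: "\<exists>x\<in>homog V 0. \<exists>y\<in>homog V 1. v = x + y"

locale superalgebra = super_vector_space A
  for A :: "('k::field, 'a::ring_1, 'z) super_space_scheme" +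
  assumes scal_mult_left: "scal A c a * b = scal A c (a * b)"
    and scal_mult_right: "a * scal A c b = scal A c (a * b)"
    and homog_one: "1 \<in> homog A 0"
    and homog_mult: "a \<in> homog A i \<Longrightarrow> b \<in> homog A j \<Longrightarrow> a * b \<in> homog A (i + j)"

definition component ::
  "('k, 'v::ab_group_add, 'z) super_space_scheme \<Rightarrow> bit \<Rightarrow> 'v \<Rightarrow> 'v" where
  "component V i v = (THE x. x \<in> homog V i \<and> v - x \<in> homog V (i + 1))"

definition koszul :: "bit \<Rightarrow> bit \<Rightarrow> 'k::ring_1" where
  "koszul i j = (if i = 1 \<and> j = 1 then - 1 else 1)"

definition ring_inverse :: "'a::ring_1 \<Rightarrow> 'a" where
  "ring_inverse x = (THE y. x * y = 1 \<and> y * x = 1)"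


section \<open>Tensor powers\<close>

text \<open>
  The tensor power of order \<open>n\<close> of \<open>A\<close> is the free vector space on the lists (tuples) of length
  \<open>n\<close>, modulo the relations of multilinearity.  All \<open>n\<close> are treated at once: \<open>tensor_class A\<close> is
  the quotient map onto the direct sum of all tensor powers, and \<open>tensor_power A n\<close> is the summand
  spanned by the classes of lists of length \<open>n\<close>.  In particular, tensor powers are associative on
  the nose, and the power of order 0 is the ground field, spanned by \<open>pure A []\<close>.
\<close>

type_synonym ('k, 'a) tensor = "('a list \<Rightarrow>\<^sub>0 'k) set"

definition free_scal :: "'k::field \<Rightarrow> ('b \<Rightarrow>\<^sub>0 'k) \<Rightarrow> ('b \<Rightarrow>\<^sub>0 'k)" where
  "free_scal c p = Poly_Mapping.map ((*) c) p"

lemma lookup_free_scal [simp]: "Poly_Mapping.lookup (free_scal c p) x = c * Poly_Mapping.lookup p x"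
  by (simp add: free_scal_def map.rep_eq when_def)

lemma vector_space_free_scal: "vector_space free_scal"
  by unfold_locales (auto intro!: poly_mapping_eqI simp: lookup_add algebra_simps)

definition tensor_relations ::
  "('k::field, 'a::ab_group_add, 'z) super_space_scheme \<Rightarrow> ('a list \<Rightarrow>\<^sub>0 'k) set" where
  "tensor_relations A =
     {Poly_Mapping.single (xs @ (a + b) # ys) 1
        - Poly_Mapping.single (xs @ a # ys) 1 - Poly_Mapping.single (xs @ b # ys) 1
      | xs ys a b. True}
   \<union> {Poly_Mapping.single (xs @ scal A c a # ys) 1 - Poly_Mapping.single (xs @ a # ys) c
      | xs ys a c. True}"

definition tensor_class ::
  "('k::field, 'a::ab_group_add, 'z) super_space_scheme \<Rightarrow> ('a list \<Rightarrow>\<^sub>0 'k) \<Rightarrow> ('k, 'a) tensor"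
  where "tensor_class A p = {q. q - p \<in> module.span free_scal (tensor_relations A)}"

definition tensor_rep :: "('k::field, 'a) tensor \<Rightarrow> ('a list \<Rightarrow>\<^sub>0 'k)" where
  "tensor_rep X = (SOME p. p \<in> X)"

definition tensor_power ::
  "('k::field, 'a::ab_group_add, 'z) super_space_scheme \<Rightarrow> nat \<Rightarrow> ('k, 'a) tensor set" where
  "tensor_power A n =
     tensor_class A ` {p. \<forall>xs\<in>Poly_Mapping.keys p. length xs = n}"

definition tensor_homog ::
  "('k::field, 'a::ab_group_add, 'z) super_space_scheme \<Rightarrow> nat \<Rightarrow> bit \<Rightarrow> ('k, 'a) tensor set" where
  "tensor_homog A n i =
     tensor_class A ` {p. \<forall>xs\<in>Poly_Mapping.keys p.
       length xs = n \<and> (\<exists>is. list_all2 (\<lambda>x j. x \<in> homog A j) xs is \<and> sum_list is = i)}"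

definition pure ::
  "('k::field, 'a::ab_group_add, 'z) super_space_scheme \<Rightarrow> 'a list \<Rightarrow> ('k, 'a) tensor" where
  "pure A xs = tensor_class A (Poly_Mapping.single xs 1)"

definition tensor_add ::
  "('k::field, 'a::ab_group_add, 'z) super_space_scheme \<Rightarrow>
   ('k, 'a) tensor \<Rightarrow> ('k, 'a) tensor \<Rightarrow> ('k, 'a) tensor" where
  "tensor_add A X Y = tensor_class A (tensor_rep X + tensor_rep Y)"

definition tensor_scal ::
  "('k::field, 'a::ab_group_add, 'z) super_space_scheme \<Rightarrow>
   'k \<Rightarrow> ('k, 'a) tensor \<Rightarrow> ('k, 'a) tensor" where
  "tensor_scal A c X = tensor_class A (free_scal c (tensor_rep X))"

definition lin_ext :: "('k::field \<Rightarrow> 'w::ab_group_add \<Rightarrow> 'w) \<Rightarrow> ('b \<Rightarrow> 'w) \<Rightarrow> ('b \<Rightarrow>\<^sub>0 'k) \<Rightarrow> 'w" where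
  "lin_ext sc f p = (\<Sum>x\<in>Poly_Mapping.keys p. sc (Poly_Mapping.lookup p x) (f x))"

text \<open>
  Linear maps out of tensor powers, induced by a multilinear function \<open>f\<close> of tuples, with values
  in tensors and in \<open>A\<close>, respectively.  They are independent of the chosen representative only if
  \<open>f\<close> is multilinear on lists of \<^emph>\<open>every\<close> length; hence functions meant for one length
  are extended by 0 to all other lengths.
\<close>

definition tensor_lift ::
  "('k::field, 'a::ab_group_add, 'z) super_space_scheme \<Rightarrow>
   ('a list \<Rightarrow> ('k, 'a) tensor) \<Rightarrow> ('k, 'a) tensor \<Rightarrow> ('k, 'a) tensor" where
  "tensor_lift A f X = tensor_class A (lin_ext free_scal (\<lambda>xs. tensor_rep (f xs)) (tensor_rep X))"

definition tensor_eval2 ::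
  "('k::field, 'a::ab_group_add, 'z) super_space_scheme \<Rightarrow>
   ('a \<Rightarrow> 'a \<Rightarrow> 'a) \<Rightarrow> ('k, 'a) tensor \<Rightarrow> 'a" where
  "tensor_eval2 A f X =
     lin_ext (scal A) (\<lambda>xs. case xs of [x, y] \<Rightarrow> f x y | _ \<Rightarrow> 0) (tensor_rep X)"

definition tensor_eval3 ::
  "('k::field, 'a::ab_group_add, 'z) super_space_scheme \<Rightarrow>
   ('a \<Rightarrow> 'a \<Rightarrow> 'a \<Rightarrow> 'a) \<Rightarrow> ('k, 'a) tensor \<Rightarrow> 'a" where
  "tensor_eval3 A f X =
     lin_ext (scal A) (\<lambda>xs. case xs of [x, y, z] \<Rightarrow> f x y z | _ \<Rightarrow> 0) (tensor_rep X)"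

definition tensor_concat ::
  "('k::field, 'a::ab_group_add, 'z) super_space_scheme \<Rightarrow>
   ('k, 'a) tensor \<Rightarrow> ('k, 'a) tensor \<Rightarrow> ('k, 'a) tensor"  (infixr \<open>\<otimes>\<index>\<close> 75) where
  "X \<otimes>\<^bsub>A\<^esub> Y = tensor_lift A (\<lambda>xs. tensor_lift A (\<lambda>ys. pure A (xs @ ys)) Y) X"

text \<open>
  \<open>tensor_map A [f\<^sub>1, \<dots>, f\<^sub>n]\<close> is the tensor product of linear maps \<open>f\<^sub>i\<close> from \<open>A\<close> into tensor powers
  of \<open>A\<close>.  It carries no Koszul signs and is used for even maps only.
\<close>

definition tensor_map ::
  "('k::field, 'a::ab_group_add, 'z) super_space_scheme \<Rightarrow>
   ('a \<Rightarrow> ('k, 'a) tensor) list \<Rightarrow> ('k, 'a) tensor \<Rightarrow> ('k, 'a) tensor" where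
  "tensor_map A fs = tensor_lift A (\<lambda>xs.
     if length xs = length fs
     then foldr (tensor_concat A) (map2 (\<lambda>f x. f x) fs xs) (pure A [])
     else tensor_class A 0)"

definition single_factor ::
  "('k::field, 'a::ab_group_add, 'z) super_space_scheme \<Rightarrow> 'a \<Rightarrow> ('k, 'a) tensor" where
  "single_factor A a = pure A [a]"

text \<open>
  The product of simple tensors of homogeneous elements is
  \<open>(a\<^sub>1 \<otimes> \<dots> \<otimes> a\<^sub>n)(b\<^sub>1 \<otimes> \<dots> \<otimes> b\<^sub>n) = \<plusminus> a\<^sub>1b\<^sub>1 \<otimes> \<dots> \<otimes> a\<^sub>nb\<^sub>n\<close>, with one sign \<open>(-1)^([a\<^sub>i][b\<^sub>j])\<close>
  for every pair \<open>i > j\<close>, since \<open>b\<^sub>j\<close> has to be moved past \<open>a\<^sub>i\<close>.  General factors are split into their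
  homogeneous components, of degrees \<open>p ! i\<close> and \<open>q ! j\<close> below.
\<close>

definition pure_mult ::
  "('k::field, 'a::ring_1, 'z) super_space_scheme \<Rightarrow> 'a list \<Rightarrow> 'a list \<Rightarrow> ('k, 'a) tensor" where
  "pure_mult A xs ys =
     (let n = length xs in
      if length ys = n then
        tensor_class A (\<Sum>p\<in>{p :: bit list. length p = n}. \<Sum>q\<in>{q :: bit list. length q = n}.
          free_scal (\<Prod>i<n. \<Prod>j<i. koszul (p ! i) (q ! j))
            (Poly_Mapping.single
              (map (\<lambda>i. component A (p ! i) (xs ! i) * component A (q ! i) (ys ! i)) [0..<n]) 1))
      else tensor_class A 0)"

definition tensor_mult ::
  "('k::field, 'a::ring_1, 'z) super_space_scheme \<Rightarrow>
   ('k, 'a) tensor \<Rightarrow> ('k, 'a) tensor \<Rightarrow> ('k, 'a) tensor"  (infixl \<open>\<cdot>\<index>\<close> 70) where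
  "X \<cdot>\<^bsub>A\<^esub> Y = tensor_lift A (\<lambda>xs. tensor_lift A (\<lambda>ys. pure_mult A xs ys) Y) X"

definition tensor_one ::
  "('k::field, 'a::ring_1, 'z) super_space_scheme \<Rightarrow> nat \<Rightarrow> ('k, 'a) tensor" where
  "tensor_one A n = pure A (replicate n 1)"

definition tensor_invertible ::
  "('k::field, 'a::ring_1, 'z) super_space_scheme \<Rightarrow> nat \<Rightarrow> ('k, 'a) tensor \<Rightarrow> bool" where
  "tensor_invertible A n X \<longleftrightarrow> X \<in> tensor_power A n \<and>
     (\<exists>Y\<in>tensor_power A n. X \<cdot>\<^bsub>A\<^esub> Y = tensor_one A n \<and> Y \<cdot>\<^bsub>A\<^esub> X = tensor_one A n)"

definition tensor_inverse ::
  "('k::field, 'a::ring_1, 'z) super_space_scheme \<Rightarrow> nat \<Rightarrow> ('k, 'a) tensor \<Rightarrow> ('k, 'a) tensor" where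
  "tensor_inverse A n X = (THE Y. Y \<in> tensor_power A n \<and>
     X \<cdot>\<^bsub>A\<^esub> Y = tensor_one A n \<and> Y \<cdot>\<^bsub>A\<^esub> X = tensor_one A n)"


section \<open>Quasi-Hopf superalgebras\<close>

record (overloaded) ('k::field, 'a) quasi_hopf = "('k, 'a) super_space" +
  coprod :: "'a \<Rightarrow> ('k, 'a) tensor"
  counit :: "'a \<Rightarrow> 'k"
  antipode :: "'a \<Rightarrow> 'a"
  alpha :: 'a
  beta :: 'a
  assoc :: "('k, 'a) tensor"

text \<open>The counit as a map into the tensor power of order 0.\<close>

definition counit_tensor ::
  "('k::field, 'a::ab_group_add, 'z) quasi_hopf_scheme \<Rightarrow> 'a \<Rightarrow> ('k, 'a) tensor" where
  "counit_tensor H a = tensor_scal H (counit H a) (pure H [])"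

locale quasi_hopf_superalgebra = superalgebra H
  for H :: "('k::field, 'a::ring_1, 'z) quasi_hopf_scheme" (structure) +
  assumes counit_add: "counit H (a + b) = counit H a + counit H b"
    and counit_scal: "counit H (scal H c a) = c * counit H a"
    and counit_mult: "counit H (a * b) = counit H a * counit H b"
    and counit_one: "counit H 1 = 1"
    and counit_grading: "a \<in> homog H 1 \<Longrightarrow> counit H a = 0"

    and coprod_closed: "coprod H a \<in> tensor_power H 2"
    and coprod_add: "coprod H (a + b) = tensor_add H (coprod H a) (coprod H b)"
    and coprod_scal: "coprod H (scal H c a) = tensor_scal H c (coprod H a)"
    and coprod_mult: "coprod H (a * b) = coprod H a \<cdot> coprod H b"
    and coprod_one: "coprod H 1 = tensor_one H 2"
    and coprod_grading: "a \<in> homog H i \<Longrightarrow> coprod H a \<in> tensor_homog H 2 i"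

    and antipode_add: "antipode H (a + b) = antipode H a + antipode H b"
    and antipode_scal: "antipode H (scal H c a) = scal H c (antipode H a)"
    and antipode_mult: "a \<in> homog H i \<Longrightarrow> b \<in> homog H j \<Longrightarrow>
      antipode H (a * b) = scal H (koszul i j) (antipode H b * antipode H a)"
    and antipode_one: "antipode H 1 = 1"
    and antipode_grading: "a \<in> homog H i \<Longrightarrow> antipode H a \<in> homog H i"
    and antipode_bij: "bij (antipode H)"

    and alpha_homog: "\<exists>i. alpha H \<in> homog H i"
    and beta_homog: "\<exists>i. beta H \<in> homog H i"
    and assoc_homog: "\<exists>i. assoc H \<in> tensor_homog H 3 i"
    and assoc_invertible: "tensor_invertible H 3 (assoc H)"

    and quasi_coassoc:
      "tensor_map H [single_factor H, coprod H] (coprod H a) =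
       tensor_inverse H 3 (assoc H) \<cdot> tensor_map H [coprod H, single_factor H] (coprod H a) \<cdot> assoc H"
    and pentagon:
      "tensor_map H [coprod H, single_factor H, single_factor H] (assoc H) \<cdot>
       tensor_map H [single_factor H, single_factor H, coprod H] (assoc H) =
       (assoc H \<otimes> single_factor H 1) \<cdot>
       tensor_map H [single_factor H, coprod H, single_factor H] (assoc H) \<cdot>
       (single_factor H 1 \<otimes> assoc H)"
    and counit_left: "tensor_map H [counit_tensor H, single_factor H] (coprod H a) = single_factor H a"
    and counit_right: "tensor_map H [single_factor H, counit_tensor H] (coprod H a) = single_factor H a"
    and counit_assoc:
      "tensor_map H [single_factor H, counit_tensor H, single_factor H] (assoc H) = tensor_one H 2"
    and antipode_alpha:
      "tensor_eval2 H (\<lambda>x y. antipode H x * alpha H * y) (coprod H a) = scal H (counit H a) (alpha H)"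
    and antipode_beta:
      "tensor_eval2 H (\<lambda>x y. x * beta H * antipode H y) (coprod H a) = scal H (counit H a) (beta H)"
    and antipode_assoc_inverse:
      "tensor_eval3 H (\<lambda>x y z. x * beta H * antipode H y * alpha H * z)
         (tensor_inverse H 3 (assoc H)) = 1"
    and antipode_assoc:
      "tensor_eval3 H (\<lambda>x y z. antipode H x * alpha H * y * beta H * antipode H z) (assoc H) = 1"

definition trace_type_element :: "('k::field, 'a::ring_1, 'z) quasi_hopf_scheme \<Rightarrow> 'a \<Rightarrow> bool" where
  "trace_type_element H u \<longleftrightarrow> u \<in> homog H 0 \<and> (\<exists>v. u * v = 1 \<and> v * u = 1) \<and>
     (\<forall>a. antipode H (antipode H a) = u * a * ring_inverse u)"

definition twistor :: "('k::field, 'a::ring_1, 'z) quasi_hopf_scheme \<Rightarrow> ('k, 'a) tensor \<Rightarrow> bool" where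
  "twistor H F \<longleftrightarrow> tensor_invertible H 2 F \<and> (\<exists>i. F \<in> tensor_homog H 2 i) \<and>
     tensor_map H [counit_tensor H, single_factor H] F = single_factor H 1 \<and>
     tensor_map H [single_factor H, counit_tensor H] F = single_factor H 1"

definition twist ::
  "('k::field, 'a::ring_1, 'z) quasi_hopf_scheme \<Rightarrow> ('k, 'a) tensor \<Rightarrow>
   ('k, 'a, 'z) quasi_hopf_scheme" where
  "twist H F = (let F' = tensor_inverse H 2 F in H\<lparr>
     coprod := (\<lambda>a. F \<cdot>\<^bsub>H\<^esub> coprod H a \<cdot>\<^bsub>H\<^esub> F'),
     alpha := tensor_eval2 H (\<lambda>x y. antipode H x * alpha H * y) F',
     beta := tensor_eval2 H (\<lambda>x y. x * beta H * antipode H y) F,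
     assoc := (F \<otimes>\<^bsub>H\<^esub> single_factor H 1) \<cdot>\<^bsub>H\<^esub> tensor_map H [coprod H, single_factor H] F
       \<cdot>\<^bsub>H\<^esub> assoc H
       \<cdot>\<^bsub>H\<^esub> tensor_map H [single_factor H, coprod H] F' \<cdot>\<^bsub>H\<^esub> (single_factor H 1 \<otimes>\<^bsub>H\<^esub> F')\<rparr>)"


section \<open>Graded modules and supertraces\<close>

record ('k, 'v, 'a) super_module = "('k, 'v) super_space" +
  act :: "'a \<Rightarrow> 'v \<Rightarrow> 'v"

locale graded_module = A: superalgebra A + V: super_vector_space V
  for A :: "('k::field, 'a::ring_1, 'y) super_space_scheme"
    and V :: "('k, 'v::ab_group_add, 'a, 'z) super_module_scheme" +
  assumes act_add_left: "act V (a + b) v = act V a v + act V b v"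
    and act_add_right: "act V a (v + w) = act V a v + act V a w"
    and act_scal_left: "act V (scal A c a) v = scal V c (act V a v)"
    and act_scal_right: "act V a (scal V c v) = scal V c (act V a v)"
    and act_mult: "act V (a * b) v = act V a (act V b v)"
    and act_one: "act V 1 v = v"
    and act_grading: "a \<in> homog A i \<Longrightarrow> v \<in> homog V j \<Longrightarrow> act V a v \<in> homog V (i + j)"

definition finite_dim :: "('k::field, 'v::ab_group_add, 'z) super_space_scheme \<Rightarrow> bool" where
  "finite_dim V \<longleftrightarrow> (\<exists>B. finite B \<and> module.span (scal V) B = UNIV)"

definition homog_basis :: "('k::field, 'v::ab_group_add, 'z) super_space_scheme \<Rightarrow> 'v set \<Rightarrow> bool" where
  "homog_basis V B \<longleftrightarrow> finite B \<and> B \<subseteq> homog V 0 \<union> homog V 1 \<and>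
     \<not> module.dependent (scal V) B \<and> module.span (scal V) B = UNIV"

text \<open>The diagonal entries of \<open>f\<close> in a homogeneous basis (which one does not matter), odd ones with sign.\<close>

definition supertrace ::
  "('k::field, 'v::ab_group_add, 'z) super_space_scheme \<Rightarrow> ('v \<Rightarrow> 'v) \<Rightarrow> 'k" where
  "supertrace V f = (let B = (SOME B. homog_basis V B) in
     \<Sum>b\<in>B. (if b \<in> homog V 0 then 1 else - 1) * module.representation (scal V) B (f b) b)"


section \<open>The trace type elements\<close>

definition trace_elt ::
  "('k::field, 'a::ring_1, 'y) quasi_hopf_scheme \<Rightarrow>
   ('k, 'v::ab_group_add, 'a, 'z) super_module_scheme \<Rightarrow> 'a \<Rightarrow> ('k, 'a) tensor \<Rightarrow> 'a" where
  "trace_elt H V u \<theta> = tensor_eval3 H (\<lambda>a b c. scal H (supertrace V (act V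
     (u * inv (antipode H) (alpha H) * b * beta H * antipode H c))) a) \<theta>"

definition trace_elt_bar ::
  "('k::field, 'a::ring_1, 'y) quasi_hopf_scheme \<Rightarrow>
   ('k, 'v::ab_group_add, 'a, 'z) super_module_scheme \<Rightarrow> 'a \<Rightarrow> ('k, 'a) tensor \<Rightarrow> 'a" where
  "trace_elt_bar H V u \<theta> = tensor_eval3 H (\<lambda>a b c. scal H (supertrace V (act V
     (ring_inverse u * antipode H (beta H) * antipode H a * alpha H * b))) c) \<theta>"

definition twist_tensor ::
  "('k::field, 'a::ring_1, 'z) quasi_hopf_scheme \<Rightarrow> ('k, 'a) tensor \<Rightarrow> ('k, 'a) tensor \<Rightarrow>
   ('k, 'a) tensor" where
  "twist_tensor H F \<theta> = (let F' = tensor_inverse H 2 F in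
     (single_factor H 1 \<otimes>\<^bsub>H\<^esub> F) \<cdot>\<^bsub>H\<^esub> tensor_map H [single_factor H, coprod H] F \<cdot>\<^bsub>H\<^esub> \<theta>
     \<cdot>\<^bsub>H\<^esub> tensor_map H [single_factor H, coprod H] F' \<cdot>\<^bsub>H\<^esub> (single_factor H 1 \<otimes>\<^bsub>H\<^esub> F'))"

definition twist_tensor_bar ::
  "('k::field, 'a::ring_1, 'z) quasi_hopf_scheme \<Rightarrow> ('k, 'a) tensor \<Rightarrow> ('k, 'a) tensor \<Rightarrow>
   ('k, 'a) tensor" where
  "twist_tensor_bar H F \<theta> = (let F' = tensor_inverse H 2 F in
     (F \<otimes>\<^bsub>H\<^esub> single_factor H 1) \<cdot>\<^bsub>H\<^esub> tensor_map H [coprod H, single_factor H] F \<cdot>\<^bsub>H\<^esub> \<theta>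
     \<cdot>\<^bsub>H\<^esub> tensor_map H [coprod H, single_factor H] F' \<cdot>\<^bsub>H\<^esub> (F' \<otimes>\<^bsub>H\<^esub> single_factor H 1))"

end

theory Submission
  imports Defs
begin

text \<open>
  The supertrace of the module enters only through the linear form \<open>\<tau>(a) = Str\<^sub>V(a)\<close>.  It vanishes on
  odd elements and is cyclic up to the Koszul sign.  For elements \<open>a\<close>, \<open>b\<close> consider the linear map
  \<open>E\<^sub>a\<^sub>b(x \<otimes> y \<otimes> z) = \<tau>(u S\<inverse>(a) y b S(z)) x\<close>.  The element \<open>C\<close> is the value of \<open>E\<^sub>a\<^sub>b\<close> at \<open>\<theta>\<close> for \<open>a = \<alpha>\<close>,
  \<open>b = \<beta>\<close>.  Two rules describe how \<open>E\<^sub>a\<^sub>b\<close> behaves under multiplication of its argument.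

  A factor \<open>1 \<otimes> p \<otimes> q\<close> on the right replaces \<open>b\<close> by \<open>p b S(q)\<close>, because the antipode is an antihomomorphism.
  The same factor on the left replaces \<open>a\<close> by \<open>S(p) a q\<close>: the factor \<open>S(q)\<close> is moved cyclically to
  the front, and the trace type condition lets it pass \<open>u\<close> as \<open>S\<inverse>(q)\<close>.  The signs are those of the
  graded product of tensors (\<open>trace_absorb_alpha\<close>, \<open>trace_absorb_beta\<close>, \<open>trace_form_mult_left\<close>,
  \<open>trace_form_mult_right\<close>).

  Summed over the terms of \<open>F\<close> and of \<open>F\<inverse>\<close>, these rules turn the twisted \<open>\<alpha>\<close> and \<open>\<beta>\<close> back into the
  original ones at the price of conjugating the argument: the twisted form at \<open>X\<close> is \<open>E\<close> at
  \<open>(1 \<otimes> F\<inverse>) X (1 \<otimes> F)\<close>.  For the twisted tensor this cancels the outermost factors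
  (\<open>trace_form_twistor\<close>).  Summed over the terms of \<open>\<Delta>(x)\<close>, the same rules and the antipode axioms for \<open>\<alpha>\<close>
  and \<open>\<beta>\<close> show that a factor \<open>1 \<otimes> \<Delta>(x)\<close> on either side contributes \<open>\<epsilon>(x)\<close> (\<open>trace_form_coprod\<close>).
  Hence \<open>(1 \<otimes> \<Delta>)F\<close> and its inverse contribute \<open>(1 \<otimes> \<epsilon>)F = 1\<close> and its inverse, and \<open>C\<close> is left.  The
  element \<open>C\<close> with a bar is treated in the same way, with cyclicity used on the other side.

  For the sign rules \<open>\<alpha>\<close>, \<open>\<beta>\<close>, \<open>F\<close> and \<open>F\<inverse>\<close> have to be even.  All of this follows from the counit being
  a homomorphism that vanishes on odd elements (\<open>alpha_beta_even\<close>, \<open>twistor_props\<close>), together with the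
  existence of even parts for \<open>F\<inverse>\<close> (\<open>inverse_even\<close>).

  Tensors are cosets in a free vector space.  All calculations take place in that free vector space,
  after a linear choice of representatives (\<open>canon\<close>, \<open>vec\<close>).  There the product of tensors becomes a
  bilinear operation \<open>\<odot>\<close>, juxtaposition an operation \<open>\<oslash>\<close>, and identities are checked on simple tensors
  with homogeneous factors.
\<close>

section \<open>The tensor algebra as a subspace of the free vector space\<close>

context vector_space begin

lemma lin_ext_superset:
  assumes "finite S" "Poly_Mapping.keys p \<subseteq> S"
  shows "lin_ext scale f p = (\<Sum>x\<in>S. scale (Poly_Mapping.lookup p x) (f x))"
  unfolding lin_ext_def using assms
  by (intro sum.mono_neutral_left) (auto simp: in_keys_iff)

lemma lin_ext_zero [simp]: "lin_ext scale f 0 = 0"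
  by (simp add: lin_ext_def)

lemma lin_ext_add [simp]: "lin_ext scale f (p + q) = lin_ext scale f p + lin_ext scale f q"
proof -
  let ?S = "Poly_Mapping.keys p \<union> Poly_Mapping.keys q"
  have "Poly_Mapping.keys (p + q) \<subseteq> ?S" by (rule Poly_Mapping.keys_add)
  then show ?thesis
    by (simp add: lin_ext_superset[of ?S] lookup_add scale_left_distrib sum.distrib)
qed

lemma lin_ext_scal [simp]: "lin_ext scale f (free_scal c p) = scale c (lin_ext scale f p)"
proof -
  have "Poly_Mapping.keys (free_scal c p) \<subseteq> Poly_Mapping.keys p"
    by (auto simp: in_keys_iff)
  then show ?thesis
    by (simp add: lin_ext_superset[of "Poly_Mapping.keys p"] scale_sum_right)
qed

lemma lin_ext_single [simp]: "lin_ext scale f (Poly_Mapping.single x c) = scale c (f x)"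
  by (simp add: lin_ext_def)

lemma lin_ext_minus: "lin_ext scale f (- p) = - lin_ext scale f p"
  using lin_ext_add[of f p "- p"] by (simp add: eq_neg_iff_add_eq_0 add.commute)

lemma lin_ext_diff [simp]: "lin_ext scale f (p - q) = lin_ext scale f p - lin_ext scale f q"
  using lin_ext_add[of f p "- q"] by (simp add: lin_ext_minus)

lemma lin_ext_fun_add: "lin_ext scale (\<lambda>x. f x + g x) p = lin_ext scale f p + lin_ext scale g p"
  by (simp add: lin_ext_def scale_right_distrib sum.distrib)

lemma lin_ext_fun_scal: "lin_ext scale (\<lambda>x. scale c (f x)) p = scale c (lin_ext scale f p)"
  by (simp add: lin_ext_def scale_sum_right mult.commute)

text \<open>
  A linear map that kills exactly the subspace \<open>R\<close> and chooses a representative in every coset of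
  \<open>R\<close>: extend a basis of \<open>R\<close> to a basis of the whole space and map the basis vectors in \<open>R\<close> to 0,
  the others to themselves.  Its range is a linear copy of the quotient by \<open>R\<close>, in which equality of
  cosets is equality of vectors.
\<close>

lemma exists_normal_form:
  assumes "subspace R"
  shows "\<exists>f. (\<forall>x y. f (x + y) = f x + f y) \<and> (\<forall>c x. f (scale c x) = scale c (f x)) \<and>
             (\<forall>x\<in>R. f x = 0) \<and> (\<forall>x. x - f x \<in> R)"
proof -
  interpret P: vector_space_pair scale scale ..
  obtain B where B: "B \<subseteq> R" "independent B" "R \<subseteq> span B"
    using basis_exists[of R] by metis
  let ?B = "extend_basis B"
  have indep: "independent ?B" and span: "span ?B = UNIV"
    using B(2) independent_extend_basis span_extend_basis by blast+
  obtain f where f: "Vector_Spaces.linear scale scale f" "\<And>x. x \<in> ?B \<Longrightarrow> f x = (if x \<in> B then 0 else x)"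
    using P.linear_independent_extend[OF indep, of "\<lambda>x. if x \<in> B then 0 else x"] by blast
  interpret f: Vector_Spaces.linear scale scale f by (rule f(1))
  have zero: "f x = 0" if "x \<in> span B" for x
    using that
    by (induction rule: span_induct_alt)
       (use f(2) extend_basis_superset[OF B(2)] in \<open>auto simp: f.add f.scale subset_iff\<close>)
  have "x - f x \<in> R" if "x \<in> span ?B" for x
    using that
  proof (induction rule: span_induct_alt)
    case base
    then show ?case using assms by (simp add: subspace_0)
  next
    case (step c x y)
    have "x - f x \<in> R"
      using f(2)[OF step(1)] B(1) assms by (auto simp: subspace_0)
    then have "scale c (x - f x) + (y - f y) \<in> R"
      using step assms by (simp add: subspace_add subspace_scale)
    then show ?case by (simp add: f.add f.scale algebra_simps scale_right_diff_distrib)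
  qed
  then show ?thesis
    using zero B(3) span f.add f.scale by (intro exI[of _ f]) auto
qed

end

interpretation free: vector_space free_scal
  by (rule vector_space_free_scal)

lemma (in vector_space) linear_lin_ext:
  fixes f :: "'e \<Rightarrow> _"
  assumes add: "\<And>p q. L (p + q) = L p + L q" and sc: "\<And>c p. L (free_scal c p) = scale c (L p)"
  shows "L (lin_ext free_scal f p) = lin_ext scale (\<lambda>x. L (f x)) p"
proof -
  have "L 0 = 0" using add[of 0 0] by simp
  then have "L (\<Sum>x\<in>S. g x) = (\<Sum>x\<in>S. L (g x))" for S and g :: "'e \<Rightarrow> _"
    by (induction S rule: infinite_finite_induct) (auto simp: add)
  then show ?thesis by (simp add: lin_ext_def sc)
qed

lemma lin_ext_single_self: "lin_ext free_scal (\<lambda>x. Poly_Mapping.single x 1) p = p"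
proof (rule poly_mapping_eqI)
  fix x
  have "Poly_Mapping.lookup (lin_ext free_scal (\<lambda>x. Poly_Mapping.single x 1) p) x
      = lin_ext (*) (\<lambda>y. Poly_Mapping.lookup (Poly_Mapping.single y 1) x) p"
    by (simp add: lin_ext_def lookup_sum)
  also have "\<dots> = Poly_Mapping.lookup p x"
    by (auto simp: lin_ext_def lookup_single when_def if_distrib sum.delta in_keys_iff cong: if_cong)
  finally show "Poly_Mapping.lookup (lin_ext free_scal (\<lambda>x. Poly_Mapping.single x 1) p) x =
      Poly_Mapping.lookup p x" .
qed

text \<open>
  A tuple may have any length, as in the definition of tensor powers; additivity and homogeneity are
  required at every position of every list.
\<close>

definition multilinear ::
  "('k \<Rightarrow> 'a \<Rightarrow> 'a) \<Rightarrow> ('k \<Rightarrow> 'w \<Rightarrow> 'w) \<Rightarrow> ('a::ab_group_add list \<Rightarrow> 'w::ab_group_add) \<Rightarrow> bool" where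
  "multilinear s t f \<longleftrightarrow>
     (\<forall>xs ys a b. f (xs @ (a + b) # ys) = f (xs @ a # ys) + f (xs @ b # ys)) \<and>
     (\<forall>xs ys c a. f (xs @ s c a # ys) = t c (f (xs @ a # ys)))"

context superalgebra begin

abbreviation null where "null \<equiv> free.span (tensor_relations A)"

text \<open>
  Tensors are sets of representatives and have no vector space type.  A fixed linear choice of
  representatives moves all computations into the free vector space, where they are plain linear
  algebra.
\<close>

definition canon :: "('a list \<Rightarrow>\<^sub>0 'k) \<Rightarrow> ('a list \<Rightarrow>\<^sub>0 'k)" where
  "canon = (SOME f. (\<forall>x y. f (x + y) = f x + f y) \<and> (\<forall>c x. f (free_scal c x) = free_scal c (f x)) \<and>
             (\<forall>x\<in>null. f x = 0) \<and> (\<forall>x. x - f x \<in> null))"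

lemma canon_props:
  "(\<forall>x y. canon (x + y) = canon x + canon y) \<and>
   (\<forall>c x. canon (free_scal c x) = free_scal c (canon x)) \<and>
   (\<forall>x\<in>null. canon x = 0) \<and> (\<forall>x. x - canon x \<in> null)"
  unfolding canon_def by (rule someI_ex[OF free.exists_normal_form[OF free.subspace_span]])

lemma canon_add [simp]: "canon (x + y) = canon x + canon y"
  and canon_scal [simp]: "canon (free_scal c x) = free_scal c (canon x)"
  and canon_null: "x \<in> null \<Longrightarrow> canon x = 0"
  and diff_canon_null: "x - canon x \<in> null"
  using canon_props by blast+

lemma canon_zero [simp]: "canon 0 = 0"
  using canon_add[of 0 0] by simp

lemma canon_diff: "canon (x - y) = canon x - canon y"
  using canon_add[of "x - y" y] by simp

lemma canon_idem [simp]: "canon (canon x) = canon x"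
  using canon_null[OF diff_canon_null[of x]] by (simp add: canon_diff)

lemma canon_eq_iff: "canon p = canon q \<longleftrightarrow> p - q \<in> null"
proof
  assume "canon p = canon q"
  moreover have "(p - canon p) - (q - canon q) \<in> null"
    by (intro free.span_diff diff_canon_null)
  ultimately show "p - q \<in> null" by simp
qed (use canon_null[of "p - q"] in \<open>simp add: canon_diff\<close>)

lemma tensor_class_eq_iff: "tensor_class A p = tensor_class A q \<longleftrightarrow> canon p = canon q"
  unfolding tensor_class_def canon_eq_iff[symmetric] by auto

text \<open>
  The coordinates of a tensor.  The representative picked by \<^const>\<open>tensor_rep\<close> is arbitrary and does
  not depend linearly on the tensor; composing it with \<open>canon\<close> makes it linear.
\<close>

definition vec :: "('k, 'a) tensor \<Rightarrow> ('a list \<Rightarrow>\<^sub>0 'k)" where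
  "vec X = canon (tensor_rep X)"

lemma vec_class [simp]: "vec (tensor_class A p) = canon p"
proof -
  have "p \<in> tensor_class A p"
    by (simp add: tensor_class_def free.span_zero)
  then have "tensor_rep (tensor_class A p) \<in> tensor_class A p"
    unfolding tensor_rep_def by (rule someI)
  then show ?thesis
    by (simp add: vec_def tensor_class_def canon_eq_iff)
qed

lemma vec_inj:
  assumes "X \<in> range (tensor_class A)" "Y \<in> range (tensor_class A)" "vec X = vec Y"
  shows "X = Y"
proof -
  obtain p q where "X = tensor_class A p" "Y = tensor_class A q"
    using assms(1,2) by blast
  then show ?thesis
    using assms(3) by (simp add: tensor_class_eq_iff)
qed

lemma canon_vec [simp]: "canon (vec X) = vec X"
  by (simp add: vec_def)

lemma vec_add [simp]: "vec (tensor_add A X Y) = vec X + vec Y"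
  by (simp add: tensor_add_def vec_def[symmetric])

lemma vec_scal [simp]: "vec (tensor_scal A c X) = free_scal c (vec X)"
  by (simp add: tensor_scal_def vec_def[symmetric])

definition tens :: "'a list \<Rightarrow> ('a list \<Rightarrow>\<^sub>0 'k)" where
  "tens xs = canon (Poly_Mapping.single xs 1)"

lemma vec_pure [simp]: "vec (pure A xs) = tens xs"
  by (simp add: pure_def tens_def)

lemma vec_single_factor [simp]: "vec (single_factor A x) = tens [x]"
  by (simp add: single_factor_def)

lemma canon_lin_ext: "canon p = lin_ext free_scal tens p"
  using free.linear_lin_ext[of canon "\<lambda>x. Poly_Mapping.single x 1" p]
  by (simp add: lin_ext_single_self tens_def[abs_def])

lemma single_scal: "Poly_Mapping.single x c = free_scal c (Poly_Mapping.single x 1)"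
  by (auto intro!: poly_mapping_eqI simp: lookup_single when_def)

lemma multilinear_tens: "multilinear (scal A) free_scal tens"
  unfolding multilinear_def
proof (intro conjI allI)
  fix xs ys a b
  have "Poly_Mapping.single (xs @ (a + b) # ys) 1
        - (Poly_Mapping.single (xs @ a # ys) 1 + Poly_Mapping.single (xs @ b # ys) 1) \<in> null"
    by (intro free.span_base) (auto simp: tensor_relations_def diff_diff_eq[symmetric])
  then show "tens (xs @ (a + b) # ys) = tens (xs @ a # ys) + tens (xs @ b # ys)"
    unfolding tens_def canon_add[symmetric] canon_eq_iff .
next
  fix xs ys c a
  have "Poly_Mapping.single (xs @ scal A c a # ys) 1 - Poly_Mapping.single (xs @ a # ys) c \<in> null"
    by (intro free.span_base) (unfold tensor_relations_def, blast)
  then show "tens (xs @ scal A c a # ys) = free_scal c (tens (xs @ a # ys))"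
    unfolding tens_def canon_scal[symmetric] canon_eq_iff single_scal[of _ c] .
qed

end

text \<open>
  The universal property of the tensor power, in the form in which it is used everywhere below:
  the linear extension of a multilinear function kills the defining relations, hence may be evaluated
  on any representative.
\<close>

lemma lin_ext_null:
  assumes "vector_space t" "multilinear (scal A) t f" "p \<in> free.span (tensor_relations A)"
  shows "lin_ext t f p = 0"
proof -
  interpret t: vector_space t by fact
  show ?thesis using assms(3)
  proof (induction rule: free.span_induct_alt)
    case (step c x y)
    have "lin_ext t f x = 0"
      using step(1) assms(2) by (auto simp: tensor_relations_def multilinear_def)
    then show ?case using step by simp
  qed simp
qed

context superalgebra begin

lemma lin_ext_canon:
  assumes "vector_space t" "multilinear (scal A) t f"
  shows "lin_ext t f (canon p) = lin_ext t f p"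
proof -
  interpret t: vector_space t by fact
  have "lin_ext t f (p - canon p) = 0"
    using lin_ext_null[OF assms diff_canon_null] .
  then show ?thesis by simp
qed

lemma lin_ext_rep:
  assumes "vector_space t" "multilinear (scal A) t f"
  shows "lin_ext t f (tensor_rep X) = lin_ext t f (vec X)"
  unfolding vec_def lin_ext_canon[OF assms] ..

lemma lin_ext_tens:
  assumes "vector_space t" "multilinear (scal A) t f"
  shows "lin_ext t f (tens xs) = f xs"
proof -
  interpret t: vector_space t by fact
  show ?thesis unfolding tens_def lin_ext_canon[OF assms] by simp
qed

text \<open>
  The choices of representatives inside \<^const>\<open>tensor_lift\<close> disappear after passing to coordinates.
\<close>

lemma vec_tensor_lift:
  assumes "multilinear (scal A) free_scal (\<lambda>xs. vec (f xs))"
  shows "vec (tensor_lift A f X) = lin_ext free_scal (\<lambda>xs. vec (f xs)) (vec X)"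
proof -
  have "vec (tensor_lift A f X) = lin_ext free_scal (\<lambda>xs. vec (f xs)) (tensor_rep X)"
    unfolding tensor_lift_def vec_class by (simp add: free.linear_lin_ext[of canon] vec_def)
  then show ?thesis by (simp add: lin_ext_rep[OF vector_space_free_scal assms])
qed

end

section \<open>Multilinear functions\<close>

lemma multilinear_zero_arg:
  assumes "multilinear s t f" "0 \<in> set xs"
  shows "f xs = 0"
proof -
  obtain us vs where "xs = us @ 0 # vs" using assms(2) by (meson split_list)
  moreover have "f (us @ (0 + 0) # vs) = f (us @ 0 # vs) + f (us @ 0 # vs)"
    using assms(1) unfolding multilinear_def by blast
  ultimately show ?thesis by simp
qed

text \<open>
  A function that is multilinear in each fixed length may be glued from different formulas for
  different lengths.
\<close>

lemma multilinear_length: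
  assumes "\<And>n. multilinear s t (f n)"
  shows "multilinear s t (\<lambda>xs. f (length xs) xs)"
  using assms by (simp add: multilinear_def)

lemma multilinear_map:
  assumes "multilinear s t f"
    and "\<And>i x y. g i (x + y) = g i x + g i y" "\<And>i c x. g i (s c x) = s c (g i x)"
  shows "multilinear s t (\<lambda>xs. f (map (\<lambda>i. g i (xs ! i)) [0..<length xs]))"
proof -
  have *: "map (\<lambda>i. g i ((xs @ a # ys) ! i)) [0..<length (xs @ a # ys)] =
      map (\<lambda>i. g i (xs ! i)) [0..<length xs] @ g (length xs) a #
      map (\<lambda>i. g (Suc (length xs) + i) (ys ! i)) [0..<length ys]" for xs ys a
    by (rule nth_equalityI) (auto simp: nth_append nth_Cons' simp del: upt_Suc)
  show ?thesis
    using assms unfolding multilinear_def * by simp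
qed

context vector_space begin

lemma multilinear_zero: "multilinear s scale (\<lambda>_. 0)"
  by (simp add: multilinear_def)

lemma multilinear_scale: "multilinear s scale f \<Longrightarrow> multilinear s scale (\<lambda>xs. scale c (f xs))"
  by (simp add: multilinear_def scale_right_distrib mult.commute)

lemma multilinear_sum:
  "(\<And>i. i \<in> I \<Longrightarrow> multilinear s scale (f i)) \<Longrightarrow> multilinear s scale (\<lambda>xs. \<Sum>i\<in>I. f i xs)"
  by (simp add: multilinear_def sum.distrib scale_sum_right)

lemma multilinear_lin_ext:
  assumes "\<And>y. multilinear s scale (\<lambda>xs. f xs y)"
  shows "multilinear s scale (\<lambda>xs. lin_ext scale (f xs) w)"
proof -
  have "f (xs @ (a + b) # ys) = (\<lambda>y. f (xs @ a # ys) y + f (xs @ b # ys) y)"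
    "f (xs @ s c a # ys) = (\<lambda>y. scale c (f (xs @ a # ys) y))" for xs ys a b c
    using assms unfolding multilinear_def by auto
  then show ?thesis
    by (simp add: multilinear_def lin_ext_fun_add lin_ext_fun_scal)
qed

lemma multilinear_if:
  "(P \<Longrightarrow> multilinear s scale f) \<Longrightarrow> multilinear s scale (\<lambda>xs. if P then f xs else 0)"
  by (cases P) (auto simp: multilinear_zero)

lemma multilinear_pair:
  assumes "\<And>x x' y. h (x + x') y = h x y + h x' y" "\<And>c x y. h (s c x) y = scale c (h x y)"
    "\<And>x y y'. h x (y + y') = h x y + h x y'" "\<And>c x y. h x (s c y) = scale c (h x y)"
  shows "multilinear s scale (\<lambda>xs. case xs of [x, y] \<Rightarrow> h x y | _ \<Rightarrow> 0)"
  unfolding multilinear_def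
proof (intro conjI allI, goal_cases)
  case (1 xs ys a b)
  show ?case
    by (cases xs; cases "tl xs"; cases ys; cases "tl ys") (auto simp: assms split: list.split)
next
  case (2 xs ys c a)
  show ?case
    by (cases xs; cases "tl xs"; cases ys; cases "tl ys") (auto simp: assms split: list.split)
qed

lemma multilinear_triple:
  assumes "\<And>x x' y z. h (x + x') y z = h x y z + h x' y z"
    "\<And>c x y z. h (s c x) y z = scale c (h x y z)"
    "\<And>x y y' z. h x (y + y') z = h x y z + h x y' z"
    "\<And>c x y z. h x (s c y) z = scale c (h x y z)"
    "\<And>x y z z'. h x y (z + z') = h x y z + h x y z'"
    "\<And>c x y z. h x y (s c z) = scale c (h x y z)"
  shows "multilinear s scale (\<lambda>xs. case xs of [x, y, z] \<Rightarrow> h x y z | _ \<Rightarrow> 0)"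
  unfolding multilinear_def
proof (intro conjI allI, goal_cases)
  case (1 xs ys a b)
  show ?case
    by (cases xs; cases "tl xs"; cases "tl (tl xs)"; cases ys; cases "tl ys"; cases "tl (tl ys)")
       (auto simp: assms split: list.split)
next
  case (2 xs ys c a)
  show ?case
    by (cases xs; cases "tl xs"; cases "tl (tl xs)"; cases ys; cases "tl ys"; cases "tl (tl ys)")
       (auto simp: assms split: list.split)
qed

end

section \<open>Signs and homogeneous components\<close>

text \<open>
  Sums of degrees are kept as sums: rewriting them to bit operations would hide the additivity of the
  sign rules.
\<close>

declare add_bit_eq_xor [simp del]

lemma bit_add_eq_0_iff: "(i :: bit) + j = 0 \<longleftrightarrow> i = j"
  by (cases i; cases j) auto

lemma koszul_0 [simp]: "koszul 0 j = 1" "koszul i 0 = 1"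
  by (simp_all add: koszul_def)

lemma koszul_add_left: "koszul (i + j) k = koszul i k * koszul j k"
  by (cases i; cases j; cases k) (auto simp: koszul_def)

lemma koszul_add_right: "koszul k (i + j) = koszul k i * koszul k j"
  by (cases i; cases j; cases k) (auto simp: koszul_def)

lemma koszul_commute: "koszul i j = koszul j i"
  by (auto simp: koszul_def)

lemma koszul_square: "koszul i j * koszul i j = 1"
  by (auto simp: koszul_def)

context super_vector_space begin

lemma homog_add [intro]: "x \<in> homog V i \<Longrightarrow> y \<in> homog V i \<Longrightarrow> x + y \<in> homog V i"
  and homog_scal [intro]: "x \<in> homog V i \<Longrightarrow> scal V c x \<in> homog V i"
  and homog_diff [intro]: "x \<in> homog V i \<Longrightarrow> y \<in> homog V i \<Longrightarrow> x - y \<in> homog V i"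
  and homog_zero [simp, intro]: "0 \<in> homog V i"
  using subspace_homog[of i] by (auto simp: subspace_add subspace_scale subspace_diff subspace_0)

lemma homog_both: "x \<in> homog V i \<Longrightarrow> x \<in> homog V (i + 1) \<Longrightarrow> x = 0"
  using homog_Int by (cases i) auto

lemma component_unique:
  assumes "x \<in> homog V i" "v - x \<in> homog V (i + 1)"
  shows "component V i v = x"
  unfolding component_def
proof (rule the_equality)
  show "x \<in> homog V i \<and> v - x \<in> homog V (i + 1)" using assms by blast
  fix y assume y: "y \<in> homog V i \<and> v - y \<in> homog V (i + 1)"
  have "y - x \<in> homog V i" using y assms by auto
  moreover have "(v - x) - (v - y) \<in> homog V (i + 1)" using y assms by blast
  ultimately show "y = x" using homog_both[of "y - x" i] by simp
qed

lemma component_props: "component V i v \<in> homog V i \<and> v - component V i v \<in> homog V (i + 1)"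
proof -
  obtain x y where xy: "x \<in> homog V 0" "y \<in> homog V 1" "v = x + y" using homog_sum by blast
  show ?thesis
  proof (cases "i = 0")
    case True
    then show ?thesis using component_unique[of x 0 v] xy by simp
  next
    case False
    then show ?thesis using component_unique[of y 1 v] xy by simp
  qed
qed

lemma component_homog [simp]: "component V i v \<in> homog V i"
  and diff_component_homog: "v - component V i v \<in> homog V (i + 1)"
  using component_props by blast+

lemma component_add [simp]: "component V i (v + w) = component V i v + component V i w"
proof (rule component_unique)
  have "(v - component V i v) + (w - component V i w) \<in> homog V (i + 1)"
    by (intro homog_add diff_component_homog)
  then show "v + w - (component V i v + component V i w) \<in> homog V (i + 1)"
    by (simp add: algebra_simps)
qed auto

lemma component_scal [simp]: "component V i (scal V c v) = scal V c (component V i v)"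
proof (rule component_unique)
  have "scal V c (v - component V i v) \<in> homog V (i + 1)"
    by (intro homog_scal diff_component_homog)
  then show "scal V c v - scal V c (component V i v) \<in> homog V (i + 1)"
    by (simp add: scale_right_diff_distrib)
qed auto

lemma component_of_homog: "v \<in> homog V j \<Longrightarrow> component V i v = (if i = j then v else 0)"
  by (cases i; cases j) (auto intro!: component_unique)

lemma component_sum: "component V 0 v + component V 1 v = v"
proof -
  have "component V 1 v = v - component V 0 v"
    using diff_component_homog[of v 0] by (intro component_unique) auto
  then show ?thesis by simp
qed

end

section \<open>The graded product of tensor powers\<close>

lemma finite_bit_lists: "finite {p :: bit list. length p = n}"
proof -
  have "(UNIV :: bit set) = {0, 1}" by (auto intro: bit.exhaust)
  then have "finite (UNIV :: bit set)" by (metis finite.emptyI finite.insertI)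
  then show ?thesis using finite_lists_length_eq[of "UNIV :: bit set" n] by simp
qed

definition koszul_sign :: "bit list \<Rightarrow> bit list \<Rightarrow> 'k::comm_ring_1" where
  "koszul_sign p q = (\<Prod>i<length p. \<Prod>j<i. koszul (p ! i) (q ! j))"

text \<open>
  Both sides are the product of the pairwise signs of \<open>p, q\<close>, of \<open>p, r\<close> and of \<open>q, r\<close>, because
  \<^const>\<open>koszul\<close> is additive in each degree.
\<close>

lemma koszul_sign_assoc:
  assumes "length p = n" "length q = n" "length r = n"
  shows "(koszul_sign p q * koszul_sign (map2 (+) p q) r :: 'k::comm_ring_1) =
    koszul_sign q r * koszul_sign p (map2 (+) q r)"
proof -
  have "koszul_sign (map2 (+) p q) r = (koszul_sign p r * koszul_sign q r :: 'k)"
    using assms by (auto simp: koszul_sign_def koszul_add_left prod.distrib[symmetric] intro!: prod.cong)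
  moreover have "koszul_sign p (map2 (+) q r) = (koszul_sign p q * koszul_sign p r :: 'k)"
    using assms by (auto simp: koszul_sign_def koszul_add_right prod.distrib[symmetric] intro!: prod.cong)
  ultimately show ?thesis by (simp add: ac_simps)
qed

lemma koszul_sign_replicate_0:
  "koszul_sign (replicate n 0) q = 1"
    "length p = n \<Longrightarrow> koszul_sign p (replicate n 0) = 1"
  by (auto simp: koszul_sign_def intro!: prod.neutral)

context superalgebra begin

lemma canon_sum: "canon (sum f S) = (\<Sum>x\<in>S. canon (f x))"
  by (induction S rule: infinite_finite_induct) auto

lemma tens_zero: "0 \<in> set xs \<Longrightarrow> tens xs = 0"
  by (rule multilinear_zero_arg[OF multilinear_tens])

lemma vec_pure_mult:
  "vec (pure_mult A xs ys) =
    (if length ys = length xs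
     then (\<Sum>p\<in>{p. length p = length xs}. \<Sum>q\<in>{q. length q = length xs}.
       free_scal (koszul_sign p q)
         (tens (map (\<lambda>i. component A (p ! i) (xs ! i) * component A (q ! i) (ys ! i)) [0..<length xs])))
     else 0)"
  unfolding pure_mult_def Let_def by (simp add: canon_sum tens_def koszul_sign_def)

lemma multilinear_tens_components:
  "multilinear (scal A) free_scal (\<lambda>xs.
     tens (map (\<lambda>i. component A (p ! i) (xs ! i) * component A (q ! i) (ys ! i)) [0..<length xs]))"
  "multilinear (scal A) free_scal (\<lambda>ys.
     tens (map (\<lambda>i. component A (p ! i) (xs ! i) * component A (q ! i) (ys ! i)) [0..<length ys]))"
  using multilinear_map[OF multilinear_tens, where g = "\<lambda>i x. component A (p ! i) x * component A (q ! i) (ys ! i)"]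
    multilinear_map[OF multilinear_tens, where g = "\<lambda>i y. component A (p ! i) (xs ! i) * component A (q ! i) y"]
  by (simp_all add: ring_distribs scal_mult_left scal_mult_right)

lemma multilinear_pure_mult_left: "multilinear (scal A) free_scal (\<lambda>xs. vec (pure_mult A xs ys))"
  unfolding vec_pure_mult
  by (rule multilinear_length[where f = "\<lambda>n xs. if length ys = n
     then (\<Sum>p\<in>{p. length p = n}. \<Sum>q\<in>{q. length q = n}.
       free_scal (koszul_sign p q)
         (tens (map (\<lambda>i. component A (p ! i) (xs ! i) * component A (q ! i) (ys ! i)) [0..<length xs])))
     else 0"])
    (intro free.multilinear_if free.multilinear_sum free.multilinear_scale multilinear_tens_components)

lemma multilinear_pure_mult_right: "multilinear (scal A) free_scal (\<lambda>ys. vec (pure_mult A xs ys))"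
proof -
  have eq: "vec (pure_mult A xs ys) = (\<lambda>n ys. if n = length xs
     then (\<Sum>p\<in>{p. length p = n}. \<Sum>q\<in>{q. length q = n}.
       free_scal (koszul_sign p q)
         (tens (map (\<lambda>i. component A (p ! i) (xs ! i) * component A (q ! i) (ys ! i)) [0..<length ys])))
     else 0) (length ys) ys" for ys
    by (simp add: vec_pure_mult)
  show ?thesis
    unfolding eq
    by (rule multilinear_length)
      (intro free.multilinear_if free.multilinear_sum free.multilinear_scale multilinear_tens_components)
qed

definition tmult :: "('a list \<Rightarrow>\<^sub>0 'k) \<Rightarrow> ('a list \<Rightarrow>\<^sub>0 'k) \<Rightarrow> ('a list \<Rightarrow>\<^sub>0 'k)"  (infixl \<open>\<odot>\<close> 70) where
  "v \<odot> w = lin_ext free_scal (\<lambda>xs. lin_ext free_scal (\<lambda>ys. vec (pure_mult A xs ys)) w) v"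

lemma tmult_linear [simp]:
  "(v + v') \<odot> w = v \<odot> w + v' \<odot> w"
    "free_scal c v \<odot> w = free_scal c (v \<odot> w)"
    "0 \<odot> w = 0"
  "v \<odot> (w + w') = v \<odot> w + v \<odot> w'"
    "v \<odot> free_scal c w = free_scal c (v \<odot> w)"
    "v \<odot> 0 = 0"
  by (simp_all add: tmult_def free.lin_ext_fun_add free.lin_ext_fun_scal) (simp add: lin_ext_def)

lemma vec_tensor_mult [simp]: "vec (X \<cdot>\<^bsub>A\<^esub> Y) = vec X \<odot> vec Y"
  unfolding tensor_mult_def tmult_def
  using vec_tensor_lift[OF multilinear_pure_mult_right]
  by (subst vec_tensor_lift) (simp_all add: free.multilinear_lin_ext multilinear_pure_mult_left)

abbreviation hlist :: "'a list \<Rightarrow> bit list \<Rightarrow> bool" where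
  "hlist \<equiv> list_all2 (\<lambda>x j. x \<in> homog A j)"

text \<open>
  Of the sum over all degree patterns in \<^const>\<open>pure_mult\<close> only the pattern of the given degrees
  survives; every other pattern produces a factor 0 somewhere.
\<close>

lemma tmult_tens:
  assumes xs: "hlist xs p" and ys: "hlist ys q" and len: "length xs = length ys"
  shows "tens xs \<odot> tens ys = free_scal (koszul_sign p q) (tens (map2 (*) xs ys))"
proof -
  let ?n = "length xs" let ?S = "{p :: bit list. length p = ?n}"
  have p: "p \<in> ?S" and q: "q \<in> ?S"
    using assms by (auto simp: list_all2_conv_all_nth)
  let ?t = "\<lambda>p' q'. tens (map (\<lambda>i. component A (p' ! i) (xs ! i) * component A (q' ! i) (ys ! i)) [0..<?n])"
  have comp: "component A (p' ! i) (xs ! i) = (if p' ! i = p ! i then xs ! i else 0)"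
    "component A (q' ! i) (ys ! i) = (if q' ! i = q ! i then ys ! i else 0)" if "i < ?n" for i p' q'
    using that assms by (auto simp: list_all2_conv_all_nth component_of_homog[of _ "p ! i"] component_of_homog[of _ "q ! i"])
  have zero: "?t p' q' = 0" if "p' \<in> ?S" "q' \<in> ?S" "p' \<noteq> p \<or> q' \<noteq> q" for p' q'
  proof -
    have "\<exists>i<?n. p' ! i \<noteq> p ! i \<or> q' ! i \<noteq> q ! i"
      using that p q by (auto simp: list_eq_iff_nth_eq)
    then obtain i where i: "i < ?n" "p' ! i \<noteq> p ! i \<or> q' ! i \<noteq> q ! i" by blast
    then have "component A (p' ! i) (xs ! i) * component A (q' ! i) (ys ! i) = 0"
      by (auto simp: comp)
    then have "0 \<in> set (map (\<lambda>i. component A (p' ! i) (xs ! i) * component A (q' ! i) (ys ! i)) [0..<?n])"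
      using i(1) by (auto intro!: rev_image_eqI[of i])
    then show ?thesis by (rule tens_zero)
  qed
  have "tens xs \<odot> tens ys = vec (pure_mult A xs ys)"
    unfolding tmult_def
    by (subst lin_ext_tens) (simp_all add: free.multilinear_lin_ext multilinear_pure_mult_left
        lin_ext_tens[OF vector_space_free_scal multilinear_pure_mult_right] vector_space_free_scal)
  also have "\<dots> = (\<Sum>p'\<in>?S. \<Sum>q'\<in>?S. free_scal (koszul_sign p' q') (?t p' q'))"
    using len by (simp add: vec_pure_mult)
  also have "\<dots> = (\<Sum>p'\<in>{p}. \<Sum>q'\<in>?S. free_scal (koszul_sign p' q') (?t p' q'))"
    using p finite_bit_lists[of ?n] by (intro sum.mono_neutral_right) (auto simp: zero intro!: sum.neutral)
  also have "\<dots> = (\<Sum>q'\<in>?S. free_scal (koszul_sign p q') (?t p q'))" by simp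
  also have "\<dots> = (\<Sum>q'\<in>{q}. free_scal (koszul_sign p q') (?t p q'))"
    using p q finite_bit_lists[of ?n] by (intro sum.mono_neutral_right) (auto simp: zero)
  also have "\<dots> = free_scal (koszul_sign p q) (?t p q)" by simp
  also have "?t p q = tens (map2 (*) xs ys)"
    using len by (intro arg_cong[of _ _ tens] nth_equalityI) (auto simp: comp)
  finally show ?thesis .
qed

section \<open>Spans of homogeneous tensors\<close>

text \<open>
  The span of simple tensors with homogeneous factors whose degree list satisfies \<open>P\<close>.  This covers
  full tensor powers (\<open>P\<close> fixes the length) and their homogeneous parts (\<open>P\<close> also fixes the sum).
\<close>

definition hspan :: "(bit list \<Rightarrow> bool) \<Rightarrow> ('a list \<Rightarrow>\<^sub>0 'k) set" where
  "hspan P = free.span {tens xs | xs ds. hlist xs ds \<and> P ds}"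

lemma hspan_tens: "hlist xs ds \<Longrightarrow> P ds \<Longrightarrow> tens xs \<in> hspan P"
  unfolding hspan_def by (intro free.span_base) blast

lemma hspan_add: "v \<in> hspan P \<Longrightarrow> w \<in> hspan P \<Longrightarrow> v + w \<in> hspan P"
  and hspan_scal: "v \<in> hspan P \<Longrightarrow> free_scal c v \<in> hspan P"
  and hspan_0: "0 \<in> hspan P"
  unfolding hspan_def by (auto intro: free.span_add free.span_scale free.span_zero)

lemma hspan_mono: "(\<And>ds. P ds \<Longrightarrow> Q ds) \<Longrightarrow> hspan P \<subseteq> hspan Q"
  unfolding hspan_def by (intro free.span_mono) blast

lemma hspan_induct [consumes 1, case_names zero add scal tens]:
  assumes "v \<in> hspan P" "Q 0" "\<And>v w. Q v \<Longrightarrow> Q w \<Longrightarrow> Q (v + w)"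
    "\<And>c v. Q v \<Longrightarrow> Q (free_scal c v)" "\<And>xs ds. hlist xs ds \<Longrightarrow> P ds \<Longrightarrow> Q (tens xs)"
  shows "Q v"
  using assms(1) unfolding hspan_def
  by (induction rule: free.span_induct_alt) (use assms in auto)

text \<open>
  The factors are split into homogeneous components one at a time; those in \<open>xs\<close> are the ones
  already split.
\<close>

lemma tens_hspan_append:
  "hlist xs ds \<Longrightarrow> tens (xs @ ys) \<in> hspan (\<lambda>ds. length ds = length xs + length ys)"
proof (induction ys arbitrary: xs ds)
  case Nil
  then show ?case by (auto intro!: hspan_tens[of xs ds] simp: list_all2_lengthD)
next
  case (Cons y ys)
  let ?P = "\<lambda>ds. length ds = length xs + length (y # ys)"
  have *: "tens (xs @ component A i y # ys) \<in> hspan ?P" for i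
    using Cons.IH[of "xs @ [component A i y]" "ds @ [i]"] Cons.prems
    by (simp add: list_all2_appendI)
  have "tens (xs @ (component A 0 y + component A 1 y) # ys) =
    tens (xs @ component A 0 y # ys) + tens (xs @ component A 1 y # ys)"
    using multilinear_tens unfolding multilinear_def by blast
  then show ?case using * by (simp add: component_sum hspan_add)
qed

lemma vec_tensor_power:
  assumes "X \<in> tensor_power A n"
  shows "vec X \<in> hspan (\<lambda>ds. length ds = n)"
proof -
  obtain p where p: "X = tensor_class A p" "\<forall>xs\<in>Poly_Mapping.keys p. length xs = n"
    using assms unfolding tensor_power_def by blast
  have "(\<Sum>xs\<in>Poly_Mapping.keys p. free_scal (Poly_Mapping.lookup p xs) (tens xs))
      \<in> hspan (\<lambda>ds. length ds = n)"
    using p(2) tens_hspan_append[of "[]" "[]"] unfolding hspan_def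
    by (intro free.span_sum free.span_scale) auto
  then show ?thesis unfolding p(1) vec_class canon_lin_ext lin_ext_def .
qed

lemma vec_tensor_homog:
  assumes "X \<in> tensor_homog A n k"
  shows "vec X \<in> hspan (\<lambda>ds. length ds = n \<and> sum_list ds = k)"
proof -
  let ?P = "\<lambda>ds :: bit list. length ds = n \<and> sum_list ds = k"
  obtain p where p: "X = tensor_class A p" "\<forall>xs\<in>Poly_Mapping.keys p.
       length xs = n \<and> (\<exists>is. hlist xs is \<and> sum_list is = k)"
    using assms unfolding tensor_homog_def by blast
  have "tens xs \<in> hspan ?P" if "xs \<in> Poly_Mapping.keys p" for xs
    using p(2) that by (metis (mono_tags, lifting) hspan_tens list_all2_lengthD)
  then have "(\<Sum>xs\<in>Poly_Mapping.keys p. free_scal (Poly_Mapping.lookup p xs) (tens xs)) \<in> hspan ?P"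
    unfolding hspan_def by (intro free.span_sum free.span_scale) auto
  then show ?thesis unfolding p(1) vec_class canon_lin_ext lin_ext_def .
qed

lemma hlist_mult: "hlist xs p \<Longrightarrow> hlist ys q \<Longrightarrow> hlist (map2 (*) xs ys) (map2 (+) p q)"
  by (auto simp: list_all2_conv_all_nth homog_mult)

lemma tmult_hspan:
  assumes "v \<in> hspan (\<lambda>ds. length ds = n)" "w \<in> hspan (\<lambda>ds. length ds = n)"
  shows "v \<odot> w \<in> hspan (\<lambda>ds. length ds = n)"
  using assms(1)
proof (induction rule: hspan_induct)
  case (tens xs p)
  show ?case using assms(2)
  proof (induction rule: hspan_induct)
    case (tens ys q)
    then show ?case using \<open>hlist xs p\<close> \<open>length p = n\<close>
      by (auto simp: tmult_tens list_all2_lengthD intro!: hspan_scal hspan_tens hlist_mult)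
  qed (auto intro: hspan_0 hspan_add hspan_scal)
qed (auto intro: hspan_0 hspan_add hspan_scal)

text \<open>
  On homogeneous simple tensors this is associativity in the algebra, up to the sign identity
  \<open>koszul_sign_assoc\<close>.
\<close>

lemma tmult_assoc:
  assumes "v \<in> hspan (\<lambda>ds. length ds = n)" "w \<in> hspan (\<lambda>ds. length ds = n)"
    "z \<in> hspan (\<lambda>ds. length ds = n)"
  shows "v \<odot> w \<odot> z = v \<odot> (w \<odot> z)"
  using assms(1)
proof (induction rule: hspan_induct)
  case v: (tens xs p)
  show ?case using assms(2)
  proof (induction rule: hspan_induct)
    case w: (tens ys q)
    show ?case using assms(3)
    proof (induction rule: hspan_induct)
      case z: (tens zs r)
      have len: "length xs = n" "length ys = n" "length zs = n"
        using v w z by (auto simp: list_all2_lengthD)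
      have *: "map2 (*) (map2 (*) xs ys) zs = map2 (*) xs (map2 (*) ys zs)"
        using len by (intro nth_equalityI) (auto simp: mult.assoc)
      show ?case
        using v w z len hlist_mult[OF v(1) w(1)] hlist_mult[OF w(1) z(1)]
        by (simp add: tmult_tens * koszul_sign_assoc[of p n q r])
    qed auto
  qed auto
qed auto

lemma tmult_one:
  assumes "v \<in> hspan (\<lambda>ds. length ds = n)"
  shows "tens (replicate n 1) \<odot> v = v" "v \<odot> tens (replicate n 1) = v"
proof -
  have one: "hlist (replicate n 1) (replicate n 0)"
    by (auto simp: list_all2_conv_all_nth homog_one)
  have m: "map2 (*) (replicate n 1) xs = xs" "map2 (*) xs (replicate n 1) = xs"
    if "length xs = n" for xs :: "'a list"
    using that by (auto intro: nth_equalityI)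
  show "tens (replicate n 1) \<odot> v = v" using assms
    by (induction rule: hspan_induct)
      (auto simp: tmult_tens[OF one] m list_all2_lengthD koszul_sign_replicate_0)
  show "v \<odot> tens (replicate n 1) = v" using assms
    by (induction rule: hspan_induct)
      (auto simp: tmult_tens[OF _ one] m list_all2_lengthD koszul_sign_replicate_0)
qed

section \<open>Concatenation and tensor products of maps\<close>

definition tconc :: "('a list \<Rightarrow>\<^sub>0 'k) \<Rightarrow> ('a list \<Rightarrow>\<^sub>0 'k) \<Rightarrow> ('a list \<Rightarrow>\<^sub>0 'k)"  (infixr \<open>\<oslash>\<close> 75) where
  "v \<oslash> w = lin_ext free_scal (\<lambda>xs. lin_ext free_scal (\<lambda>ys. tens (xs @ ys)) w) v"

lemma tconc_linear [simp]:
  "(v + v') \<oslash> w = v \<oslash> w + v' \<oslash> w"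
    "free_scal c v \<oslash> w = free_scal c (v \<oslash> w)"
    "0 \<oslash> w = 0"
  "v \<oslash> (w + w') = v \<oslash> w + v \<oslash> w'"
    "v \<oslash> free_scal c w = free_scal c (v \<oslash> w)"
    "v \<oslash> 0 = 0"
  by (simp_all add: tconc_def free.lin_ext_fun_add free.lin_ext_fun_scal) (simp add: lin_ext_def)

lemma multilinear_tens_append:
  "multilinear (scal A) free_scal (\<lambda>ys. tens (xs @ ys))"
  "multilinear (scal A) free_scal (\<lambda>xs. tens (xs @ ys))"
  using multilinear_tens unfolding multilinear_def by (simp_all flip: append_assoc) simp_all

lemma vec_tensor_concat [simp]: "vec (X \<otimes>\<^bsub>A\<^esub> Y) = vec X \<oslash> vec Y"
proof -
  have "vec (tensor_lift A (\<lambda>ys. pure A (xs @ ys)) Y) = lin_ext free_scal (\<lambda>ys. tens (xs @ ys)) (vec Y)" for xs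
    by (subst vec_tensor_lift) (simp_all add: multilinear_tens_append)
  then show ?thesis
    unfolding tensor_concat_def tconc_def
    by (subst vec_tensor_lift) (simp_all add: free.multilinear_lin_ext multilinear_tens_append)
qed

lemma tconc_tens [simp]: "tens xs \<oslash> tens ys = tens (xs @ ys)"
  unfolding tconc_def
  by (simp add: lin_ext_tens vector_space_free_scal multilinear_tens_append free.multilinear_lin_ext)

lemma tconc_Nil: "canon w = w \<Longrightarrow> w \<oslash> tens [] = w"
  unfolding tconc_def
  by (simp add: lin_ext_tens vector_space_free_scal multilinear_tens_append canon_lin_ext)

definition tmap ::
  "('a \<Rightarrow> ('a list \<Rightarrow>\<^sub>0 'k)) \<Rightarrow> ('a \<Rightarrow> ('a list \<Rightarrow>\<^sub>0 'k)) \<Rightarrow>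
   ('a list \<Rightarrow>\<^sub>0 'k) \<Rightarrow> ('a list \<Rightarrow>\<^sub>0 'k)" where
  "tmap f g = lin_ext free_scal (\<lambda>xs. case xs of [x, y] \<Rightarrow> f x \<oslash> g y | _ \<Rightarrow> 0)"

lemma tmap_linear [simp]:
  "tmap f g (v + w) = tmap f g v + tmap f g w"
  "tmap f g (free_scal c v) = free_scal c (tmap f g v)" "tmap f g 0 = 0"
  by (simp_all add: tmap_def)

definition tensor_linear :: "('a \<Rightarrow> ('a list \<Rightarrow>\<^sub>0 'k)) \<Rightarrow> bool" where
  "tensor_linear f \<longleftrightarrow> (\<forall>x y. f (x + y) = f x + f y) \<and> (\<forall>c x. f (scal A c x) = free_scal c (f x))"

lemma multilinear_tmap:
  assumes "tensor_linear f" "tensor_linear g"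
  shows "multilinear (scal A) free_scal (\<lambda>xs. case xs of [x, y] \<Rightarrow> f x \<oslash> g y | _ \<Rightarrow> 0)"
  using assms by (intro free.multilinear_pair) (auto simp: tensor_linear_def)

lemma tmap_tens:
  assumes "tensor_linear f" "tensor_linear g"
  shows "tmap f g (tens [x, y]) = f x \<oslash> g y"
  unfolding tmap_def lin_ext_tens[OF vector_space_free_scal multilinear_tmap[OF assms]] by simp

lemma vec_tensor_map:
  assumes "tensor_linear (\<lambda>x. vec (f x))" "tensor_linear (\<lambda>x. vec (g x))"
  shows "vec (tensor_map A [f, g] X) = tmap (\<lambda>x. vec (f x)) (\<lambda>x. vec (g x)) (vec X)"
proof -
  have *: "vec (if length xs = length [f, g]
     then foldr (tensor_concat A) (map2 (\<lambda>f x. f x) [f, g] xs) (pure A [])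
     else tensor_class A 0) = (case xs of [x, y] \<Rightarrow> vec (f x) \<oslash> vec (g y) | _ \<Rightarrow> 0)" for xs
    by (auto split: list.split simp: tconc_Nil)
  show ?thesis
    unfolding tensor_map_def tmap_def
    by (subst vec_tensor_lift) (unfold *, auto intro!: multilinear_tmap assms)
qed

lemma tensor_linear_tens: "tensor_linear (\<lambda>x. tens [x])"
  using multilinear_tens[unfolded multilinear_def, THEN conjunct1, rule_format, of "[]" _ _ "[]"]
    multilinear_tens[unfolded multilinear_def, THEN conjunct2, rule_format, of "[]" _ _ "[]"]
  by (simp add: tensor_linear_def)

end

section \<open>The supertrace\<close>

context super_vector_space begin

lemma exists_homog_basis:
  assumes "finite_dim V"
  shows "\<exists>B. homog_basis V B"
proof -
  obtain T where T: "finite T" "span T = UNIV" using assms unfolding finite_dim_def by blast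
  obtain B where B: "B \<subseteq> homog V 0 \<union> homog V 1" "independent B" "homog V 0 \<union> homog V 1 \<subseteq> span B"
    using basis_exists[of "homog V 0 \<union> homog V 1"] by metis
  have "v \<in> span B" for v
  proof -
    obtain x y where "x \<in> homog V 0" "y \<in> homog V 1" "v = x + y" using homog_sum by blast
    then show ?thesis using B(3) by (auto intro!: span_add)
  qed
  moreover have "finite B" using independent_span_bound[OF T(1) B(2)] T(2) by simp
  ultimately show ?thesis using B unfolding homog_basis_def by blast
qed

text \<open>
  The component of degree \<open>j\<close> of the basis expansion of \<open>v\<close> is an expansion of \<open>v\<close> itself that
  uses basis vectors of degree \<open>j\<close> only.
\<close>

lemma representation_homog:
  assumes B: "homog_basis V B" and v: "v \<in> homog V j" and b: "representation B v b \<noteq> 0"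
  shows "b \<in> homog V j"
proof -
  have fin: "finite B" and ind: "independent B" and sp: "span B = UNIV" and
    hom: "B \<subseteq> homog V 0 \<union> homog V 1"
    using B unfolding homog_basis_def by auto
  have comp_sum: "component V j (\<Sum>b\<in>S. f b) = (\<Sum>b\<in>S. component V j (f b))" for S and f :: "'v \<Rightarrow> 'v"
    by (induction S rule: infinite_finite_induct) (auto simp: component_of_homog[of 0 j])
  have "component V j b \<in> span (B \<inter> homog V j)" if bB: "b \<in> B" for b
  proof -
    obtain i where i: "b \<in> homog V i" using hom bB by blast
    show ?thesis
      using bB i by (auto simp: component_of_homog[OF i] intro: span_base span_zero)
  qed
  then have "(\<Sum>b\<in>B. scal V (representation B v b) (component V j b)) \<in> span (B \<inter> homog V j)"
    by (intro span_sum span_scale)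
  also have "(\<Sum>b\<in>B. scal V (representation B v b) (component V j b)) =
      component V j (\<Sum>b\<in>B. scal V (representation B v b) b)"
    by (simp add: comp_sum)
  also have "\<dots> = v"
    using v by (subst sum_representation_eq) (auto simp: ind sp fin component_of_homog)
  finally have "representation B v b = representation (B \<inter> homog V j) v b"
    using representation_extend[OF ind] by auto
  then show ?thesis using b representation_ne_zero by fastforce
qed

text \<open>
  In matrix form both sides are sums over the same products of matrix entries \<open>f\<^sub>b\<^sub>c g\<^sub>c\<^sub>b\<close>.  Such a
  product vanishes unless \<open>b\<close> and \<open>c\<close> differ in degree by both \<open>i\<close> and \<open>i'\<close>, and then the signs
  attached to \<open>b\<close> and to \<open>c\<close> differ by exactly the Koszul sign.
\<close>

lemma supertrace_cyclic:
  assumes fd: "finite_dim V"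
    and f: "\<And>x y. f (x + y) = f x + f y" "\<And>c x. f (scal V c x) = scal V c (f x)"
      "\<And>j v. v \<in> homog V j \<Longrightarrow> f v \<in> homog V (i + j)"
    and g: "\<And>x y. g (x + y) = g x + g y" "\<And>c x. g (scal V c x) = scal V c (g x)"
      "\<And>j v. v \<in> homog V j \<Longrightarrow> g v \<in> homog V (i' + j)"
  shows "supertrace V (\<lambda>v. f (g v)) = koszul i i' * supertrace V (\<lambda>v. g (f v))"
proof -
  define B where "B = (SOME B. homog_basis V B)"
  have B: "homog_basis V B"
    unfolding B_def using exists_homog_basis[OF fd] by (rule someI_ex)
  have fin: "finite B" and ind: "independent B" and sp: "span B = UNIV" and
    hom: "B \<subseteq> homog V 0 \<union> homog V 1"
    using B unfolding homog_basis_def by auto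
  let ?r = "representation B"
  define s :: "'v \<Rightarrow> 'k" where "s = (\<lambda>b. if b \<in> homog V 0 then 1 else - 1)"
  have rep: "?r (h w) b = (\<Sum>c\<in>B. ?r w c * ?r (h c) b)"
    if h: "\<And>x y. h (x + y) = h x + h y" "\<And>c x. h (scal V c x) = scal V c (h x)" for h w b
  proof -
    have h_sum: "h (\<Sum>b\<in>S. k b) = (\<Sum>b\<in>S. h (k b))" for S and k :: "'v \<Rightarrow> 'v"
      using h(2)[of 0 0] by (induction S rule: infinite_finite_induct) (auto simp: h)
    have "h w = h (\<Sum>c\<in>B. scal V (?r w c) c)"
      by (subst sum_representation_eq) (auto simp: ind sp fin)
    then have "?r (h w) = ?r (\<Sum>c\<in>B. scal V (?r w c) (h c))"
      by (simp add: h_sum h(2))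
    then show ?thesis
      using ind sp by (simp add: representation_sum representation_scale)
  qed
  have sign: "s b * (?r (g b) c * ?r (f c) b) = koszul i i' * (s c * (?r (f c) b * ?r (g b) c))"
    if bc: "b \<in> B" "c \<in> B" for b c
  proof (cases "?r (g b) c = 0 \<or> ?r (f c) b = 0")
    case False
    obtain j k where jk: "b \<in> homog V j" "c \<in> homog V k" using bc hom by blast
    have c: "c \<in> homog V (i' + j)" using representation_homog[OF B g(3)[OF jk(1)]] False by blast
    have b: "b \<in> homog V (i + k)" using representation_homog[OF B f(3)[OF jk(2)]] False by blast
    have nz: "b \<noteq> 0" "c \<noteq> 0" using bc ind dependent_zero by blast+
    have uniq: "l = m" if "x \<in> homog V l" "x \<in> homog V m" "x \<noteq> 0" for x l m
      using component_of_homog[OF that(1), of m] component_of_homog[OF that(2), of m] that(3) by metis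
    have eq: "k = i' + j" "j = i + k"
      using uniq[OF jk(2) c nz(2)] uniq[OF jk(1) b nz(1)] .
    have s: "s b = (if j = 0 then 1 else -1)" "s c = (if k = 0 then 1 else - 1)"
      unfolding s_def using uniq[OF jk(1) _ nz(1), of 0] uniq[OF jk(2) _ nz(2), of 0] jk by metis+
    show ?thesis
      using eq(1) eq(2)[unfolded eq(1)] unfolding s by (cases i; cases i'; cases j; simp add: koszul_def)
  qed auto
  have str: "supertrace V h = (\<Sum>b\<in>B. s b * ?r (h b) b)" for h
    by (simp add: supertrace_def Let_def B_def[symmetric] s_def)
  have "supertrace V (\<lambda>v. f (g v)) = (\<Sum>b\<in>B. \<Sum>c\<in>B. s b * (?r (g b) c * ?r (f c) b))"
    unfolding str by (intro sum.cong refl) (subst rep[OF f(1,2)], simp add: sum_distrib_left)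
  also have "\<dots> = (\<Sum>b\<in>B. \<Sum>c\<in>B. koszul i i' * (s c * (?r (f c) b * ?r (g b) c)))"
    by (intro sum.cong refl sign)
  also have "\<dots> = (\<Sum>c\<in>B. \<Sum>b\<in>B. koszul i i' * (s c * (?r (f c) b * ?r (g b) c)))"
    by (rule sum.swap)
  also have "\<dots> = koszul i i' * supertrace V (\<lambda>v. g (f v))"
    unfolding str sum_distrib_left
    by (intro sum.cong refl) (subst rep[OF g(1,2)], simp add: sum_distrib_left)
  finally show ?thesis .
qed

lemma supertrace_odd:
  assumes fd: "finite_dim V" and f: "\<And>j v. v \<in> homog V j \<Longrightarrow> f v \<in> homog V (1 + j)"
  shows "supertrace V f = 0"
proof -
  define B where "B = (SOME B. homog_basis V B)"
  have B: "homog_basis V B"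
    unfolding B_def using exists_homog_basis[OF fd] by (rule someI_ex)
  have "representation B (f b) b = 0" if b: "b \<in> B" for b
  proof (rule ccontr)
    assume nz: "representation B (f b) b \<noteq> 0"
    obtain j where j: "b \<in> homog V j" using B b unfolding homog_basis_def by blast
    have "b \<in> homog V (1 + j)" using representation_homog[OF B f[OF j] nz] .
    then have "b = 0" using homog_both[OF j] by (simp add: add.commute)
    then show False using B b dependent_zero unfolding homog_basis_def by blast
  qed
  then show ?thesis by (simp add: supertrace_def Let_def B_def[symmetric])
qed

lemma supertrace_linear:
  assumes fd: "finite_dim V"
  shows "supertrace V (\<lambda>v. f v + g v) = supertrace V f + supertrace V g"
    and "supertrace V (\<lambda>v. scal V c (f v)) = c * supertrace V f"
proof -
  define B where "B = (SOME B. homog_basis V B)"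
  have B: "homog_basis V B"
    unfolding B_def using exists_homog_basis[OF fd] by (rule someI_ex)
  then have B': "independent B" "span B = UNIV" unfolding homog_basis_def by auto
  show "supertrace V (\<lambda>v. f v + g v) = supertrace V f + supertrace V g"
    by (simp add: supertrace_def Let_def B_def[symmetric] representation_add B' sum.distrib[symmetric] algebra_simps)
  show "supertrace V (\<lambda>v. scal V c (f v)) = c * supertrace V f"
    by (simp add: supertrace_def Let_def B_def[symmetric] representation_scale B' sum_distrib_left algebra_simps)
qed

end

locale graded_trace = superalgebra A
  for A :: "('k::field, 'a::ring_1, 'z) super_space_scheme" +
  fixes \<tau> :: "'a \<Rightarrow> 'k"
  assumes trace_add [simp]: "\<tau> (a + b) = \<tau> a + \<tau> b"
    and trace_scal [simp]: "\<tau> (scal A c a) = c * \<tau> a"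
    and trace_odd: "a \<in> homog A 1 \<Longrightarrow> \<tau> a = 0"
    and trace_cyclic: "a \<in> homog A i \<Longrightarrow> b \<in> homog A j \<Longrightarrow> \<tau> (a * b) = koszul i j * \<tau> (b * a)"

lemma (in graded_module) graded_trace_supertrace:
  assumes "finite_dim V"
  shows "graded_trace A (\<lambda>a. supertrace V (act V a))"
proof
  fix a b c
  have "act V (a + b) = (\<lambda>v. act V a v + act V b v)" by (auto simp: act_add_left)
  then show "supertrace V (act V (a + b)) = supertrace V (act V a) + supertrace V (act V b)"
    by (simp add: V.supertrace_linear[OF assms])
  have "act V (scal A c a) = (\<lambda>v. scal V c (act V a v))" by (auto simp: act_scal_left)
  then show "supertrace V (act V (scal A c a)) = c * supertrace V (act V a)"
    by (simp add: V.supertrace_linear[OF assms])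
next
  fix a assume "a \<in> homog A 1"
  then show "supertrace V (act V a) = 0"
    by (intro V.supertrace_odd assms act_grading)
next
  fix a b i j assume ab: "a \<in> homog A i" "b \<in> homog A j"
  have "act V (a * b) = (\<lambda>v. act V a (act V b v))" "act V (b * a) = (\<lambda>v. act V b (act V a v))"
    by (auto simp: act_mult)
  then show "supertrace V (act V (a * b)) = koszul i j * supertrace V (act V (b * a))"
    using ab V.supertrace_cyclic[OF assms, of "act V a" i "act V b" j]
    by (simp add: act_add_right act_scal_right act_grading)
qed

section \<open>Inverse tensors\<close>

context superalgebra begin

lemma tensor_power_class: "X \<in> tensor_power A n \<Longrightarrow> X \<in> range (tensor_class A)"
  unfolding tensor_power_def by blast

lemma vec_tensor_one [simp]: "vec (tensor_one A n) = tens (replicate n 1)"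
  by (simp add: tensor_one_def)

text \<open>
  The description of \<^const>\<open>tensor_inverse\<close> is meaningful because two-sided inverses are unique,
  which needs the associativity of the product of tensors.
\<close>

lemma vec_tensor_inverse:
  assumes "tensor_invertible A n X"
  shows "vec (tensor_inverse A n X) \<in> hspan (\<lambda>ds. length ds = n)"
    "vec X \<odot> vec (tensor_inverse A n X) = tens (replicate n 1)"
    "vec (tensor_inverse A n X) \<odot> vec X = tens (replicate n 1)"
proof -
  let ?P = "\<lambda>Y. Y \<in> tensor_power A n \<and> X \<cdot>\<^bsub>A\<^esub> Y = tensor_one A n \<and> Y \<cdot>\<^bsub>A\<^esub> X = tensor_one A n"
  obtain Y where Y: "?P Y" and X: "X \<in> tensor_power A n"
    using assms unfolding tensor_invertible_def by blast
  have inv_prop: "vec Z \<in> hspan (\<lambda>ds. length ds = n)" "vec X \<odot> vec Z = tens (replicate n 1)"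
    "vec Z \<odot> vec X = tens (replicate n 1)" if Z: "?P Z" for Z
  proof -
    show "vec Z \<in> hspan (\<lambda>ds. length ds = n)" using Z vec_tensor_power by blast
    show "vec X \<odot> vec Z = tens (replicate n 1)" "vec Z \<odot> vec X = tens (replicate n 1)"
      using Z unfolding vec_tensor_mult[symmetric] by (simp_all only: vec_tensor_one)
  qed
  have uniq: "Z = Y" if Z: "?P Z" for Z
  proof (rule vec_inj)
    have "vec Z = vec Z \<odot> (vec X \<odot> vec Y)"
      using inv_prop[OF Y] inv_prop[OF Z] by (simp add: tmult_one)
    also have "\<dots> = vec Z \<odot> vec X \<odot> vec Y"
      by (rule tmult_assoc[symmetric, OF inv_prop(1)[OF Z] vec_tensor_power[OF X] inv_prop(1)[OF Y]])
    finally show "vec Z = vec Y"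
      using inv_prop[OF Y] inv_prop[OF Z] by (simp add: tmult_one)
  qed (use Y Z tensor_power_class in auto)
  have "tensor_inverse A n X = Y"
    unfolding tensor_inverse_def by (rule the_equality[of ?P, OF Y uniq])
  then show "vec (tensor_inverse A n X) \<in> hspan (\<lambda>ds. length ds = n)"
    "vec X \<odot> vec (tensor_inverse A n X) = tens (replicate n 1)"
    "vec (tensor_inverse A n X) \<odot> vec X = tens (replicate n 1)"
    using inv_prop[OF Y] by simp_all
qed

abbreviation even2 where "even2 \<equiv> hspan (\<lambda>ds. length ds = 2 \<and> sum_list ds = 0)"
abbreviation all2 where "all2 \<equiv> hspan (\<lambda>ds. length ds = 2)"
abbreviation all3 where "all3 \<equiv> hspan (\<lambda>ds. length ds = 3)"

lemma even2_all2: "even2 \<subseteq> all2" by (rule hspan_mono) simp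

lemma hlist_two: "hlist xs ds \<Longrightarrow> length ds = 2 \<Longrightarrow>
   \<exists>x y i j. xs = [x, y] \<and> ds = [i, j] \<and> x \<in> homog A i \<and> y \<in> homog A j"
  by (auto simp: length_Suc_conv numeral_2_eq_2 list_all2_Cons2)

lemma hlist_three: "hlist xs ds \<Longrightarrow> length ds = 3 \<Longrightarrow>
   \<exists>x y z i j k. xs = [x, y, z] \<and> ds = [i, j, k] \<and> x \<in> homog A i \<and> y \<in> homog A j \<and> z \<in> homog A k"
  by (auto simp: length_Suc_conv numeral_3_eq_3 list_all2_Cons2)

lemma hspan2_induct [consumes 1, case_names zero add scal tens]:
  assumes "v \<in> all2" "Q 0" "\<And>v w. Q v \<Longrightarrow> Q w \<Longrightarrow> Q (v + w)"
    "\<And>c v. Q v \<Longrightarrow> Q (free_scal c v)" "\<And>x y i j. x \<in> homog A i \<Longrightarrow> y \<in> homog A j \<Longrightarrow> Q (tens [x, y])"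
  shows "Q v"
  using assms(1)
proof (induction rule: hspan_induct)
  case (tens xs ds)
  then obtain x y i j where "xs = [x, y]" "x \<in> homog A i" "y \<in> homog A j"
    using hlist_two by blast
  then show ?case using assms(5) by simp
qed (use assms in auto)

lemma hspan2_homog_induct [consumes 1, case_names zero add scal tens]:
  assumes "v \<in> hspan (\<lambda>ds. length ds = 2 \<and> sum_list ds = k)" "Q 0" "\<And>v w. Q v \<Longrightarrow> Q w \<Longrightarrow> Q (v + w)"
    "\<And>c v. Q v \<Longrightarrow> Q (free_scal c v)"
    "\<And>x y i j. x \<in> homog A i \<Longrightarrow> y \<in> homog A j \<Longrightarrow> i + j = k \<Longrightarrow> Q (tens [x, y])"
  shows "Q v"
  using assms(1)
proof (induction rule: hspan_induct)
  case (tens xs ds)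
  then obtain x y i j where "xs = [x, y]" "ds = [i, j]" "x \<in> homog A i" "y \<in> homog A j"
    using hlist_two by blast
  then show ?case using assms(5) tens by simp
qed (use assms in auto)

lemma hspan3_induct [consumes 1, case_names zero add scal tens]:
  assumes "v \<in> all3" "Q 0" "\<And>v w. Q v \<Longrightarrow> Q w \<Longrightarrow> Q (v + w)"
    "\<And>c v. Q v \<Longrightarrow> Q (free_scal c v)"
    "\<And>x y z i j k. x \<in> homog A i \<Longrightarrow> y \<in> homog A j \<Longrightarrow> z \<in> homog A k \<Longrightarrow> Q (tens [x, y, z])"
  shows "Q v"
  using assms(1)
proof (induction rule: hspan_induct)
  case (tens xs ds)
  then obtain x y z i j k where "xs = [x, y, z]" "x \<in> homog A i" "y \<in> homog A j" "z \<in> homog A k"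
    using hlist_three by blast
  then show ?case using assms(5) by simp
qed (use assms in auto)

lemma tens_all3: "tens [x, y, z] \<in> all3"
  using tens_hspan_append[of "[]" "[]" "[x, y, z]"] by (simp add: numeral_3_eq_3)

lemma tens_1_tconc_all3:
  assumes "w \<in> all2"
  shows "tens [x] \<oslash> w \<in> all3" "w \<oslash> tens [x] \<in> all3"
proof -
  have "tens [x] \<oslash> w \<in> all3 \<and> w \<oslash> tens [x] \<in> all3"
    using assms
    by (induction rule: hspan2_induct)
      (auto intro!: hspan_0 hspan_add hspan_scal tens_all3)
  then show "tens [x] \<oslash> w \<in> all3" "w \<oslash> tens [x] \<in> all3" by blast+
qed

lemma tmap_all3:
  assumes "tensor_linear g" "\<And>x. g x \<in> all2" "v \<in> all2"
  shows "tmap (\<lambda>x. tens [x]) g v \<in> all3" "tmap g (\<lambda>x. tens [x]) v \<in> all3"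
proof -
  have "tmap (\<lambda>x. tens [x]) g v \<in> all3 \<and> tmap g (\<lambda>x. tens [x]) v \<in> all3"
    using assms(3)
    by (induction rule: hspan2_induct)
      (auto intro!: hspan_0 hspan_add hspan_scal tens_1_tconc_all3 assms(2)
        simp: tmap_tens assms(1) tensor_linear_tens)
  then show "tmap (\<lambda>x. tens [x]) g v \<in> all3" "tmap g (\<lambda>x. tens [x]) v \<in> all3" by blast+
qed

lemma koszul_sign_2: "koszul_sign [i, j] [k, l] = koszul j k"
  by (simp add: koszul_sign_def numeral_2_eq_2 lessThan_Suc)

lemma koszul_sign_3: "koszul_sign [i, j, k] [i', j', k'] = koszul j i' * (koszul k i' * koszul k j')"
  by (simp add: koszul_sign_def numeral_3_eq_3 lessThan_Suc mult.commute)

lemma tmult_tens_2: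
  assumes "x \<in> homog A i" "y \<in> homog A j" "x' \<in> homog A i'" "y' \<in> homog A j'"
  shows "tens [x, y] \<odot> tens [x', y'] = free_scal (koszul j i') (tens [x * x', y * y'])"
  using tmult_tens[of "[x, y]" "[i, j]" "[x', y']" "[i', j']"] assms by (simp add: koszul_sign_2)

lemma tmult_tens_3:
  assumes "x \<in> homog A i" "y \<in> homog A j" "z \<in> homog A k"
    "x' \<in> homog A i'" "y' \<in> homog A j'" "z' \<in> homog A k'"
  shows "tens [x, y, z] \<odot> tens [x', y', z'] =
    free_scal (koszul j i' * (koszul k i' * koszul k j')) (tens [x * x', y * y', z * z'])"
  using tmult_tens[of "[x, y, z]" "[i, j, k]" "[x', y', z']" "[i', j', k']"] assms
  by (simp add: koszul_sign_3)

lemma tmult_tconc_one: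
  assumes "v \<in> all2" "w \<in> all2"
  shows "(tens [1] \<oslash> v) \<odot> (tens [1] \<oslash> w) = tens [1] \<oslash> (v \<odot> w)"
    "(v \<oslash> tens [1]) \<odot> (w \<oslash> tens [1]) = (v \<odot> w) \<oslash> tens [1]"
proof -
  have "(tens [1] \<oslash> v) \<odot> (tens [1] \<oslash> w) = tens [1] \<oslash> (v \<odot> w) \<and>
      (v \<oslash> tens [1]) \<odot> (w \<oslash> tens [1]) = (v \<odot> w) \<oslash> tens [1]"
    using assms(1)
  proof (induction rule: hspan2_induct)
    case v: (tens p q d e)
    show ?case using assms(2)
    proof (induction rule: hspan2_induct)
      case w: (tens x y i j)
      show ?case
        by (simp add: tmult_tens_2[OF v w] tmult_tens_3[OF homog_one v homog_one w]
            tmult_tens_3[OF v homog_one w homog_one])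
    qed auto
  qed auto
  then show "(tens [1] \<oslash> v) \<odot> (tens [1] \<oslash> w) = tens [1] \<oslash> (v \<odot> w)"
    "(v \<oslash> tens [1]) \<odot> (w \<oslash> tens [1]) = (v \<odot> w) \<oslash> tens [1]" by blast+
qed

text \<open>
  The projection of the second tensor power onto its even part along the odd one.
\<close>

definition even_part :: "('a list \<Rightarrow>\<^sub>0 'k) \<Rightarrow> ('a list \<Rightarrow>\<^sub>0 'k)" where
  "even_part = lin_ext free_scal (\<lambda>xs. case xs of [x, y] \<Rightarrow>
     tens [component A 0 x, component A 0 y] + tens [component A 1 x, component A 1 y] | _ \<Rightarrow> 0)"

lemma tens_2_linear:
  "tens [x + x', y] = tens [x, y] + tens [x', y]" "tens [scal A c x, y] = free_scal c (tens [x, y])"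
  "tens [x, y + y'] = tens [x, y] + tens [x, y']" "tens [x, scal A c y] = free_scal c (tens [x, y])"
proof -
  note m = multilinear_tens[unfolded multilinear_def]
  from m[THEN conjunct1, rule_format, of "[]" x x' "[y]"] m[THEN conjunct2, rule_format, of "[]" c x "[y]"]
    m[THEN conjunct1, rule_format, of "[x]" y y' "[]"] m[THEN conjunct2, rule_format, of "[x]" c y "[]"]
  show "tens [x + x', y] = tens [x, y] + tens [x', y]" "tens [scal A c x, y] = free_scal c (tens [x, y])"
  "tens [x, y + y'] = tens [x, y] + tens [x, y']" "tens [x, scal A c y] = free_scal c (tens [x, y])"
    by simp_all
qed

lemma even_part_linear [simp]: "even_part (v + w) = even_part v + even_part w" "even_part (free_scal c v) = free_scal c (even_part v)"
  "even_part 0 = 0"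
  by (simp_all add: even_part_def)

lemma even_part_tens:
  assumes "x \<in> homog A i" "y \<in> homog A j"
  shows "even_part (tens [x, y]) = (if i = j then tens [x, y] else 0)"
proof -
  have "even_part (tens [x, y]) = tens [component A 0 x, component A 0 y] + tens [component A 1 x, component A 1 y]"
    unfolding even_part_def
    by (subst lin_ext_tens) (auto intro!: free.multilinear_pair vector_space_free_scal
        simp: tens_2_linear algebra_simps free.scale_right_distrib)
  also have "\<dots> = (if i = j then tens [x, y] else 0)"
    unfolding component_of_homog[OF assms(1)] component_of_homog[OF assms(2)]
    by (cases i; cases j) (auto simp: tens_zero)
  finally show ?thesis .
qed

lemma even_part_even2:
  assumes "v \<in> all2" shows "even_part v \<in> even2"
  using assms
proof (induction rule: hspan2_induct)
  case (tens x y i j)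
  then show ?case
    using hspan_tens[of "[x, y]" "[i, j]" "\<lambda>ds. length ds = 2 \<and> sum_list ds = 0"]
    by (simp add: even_part_tens[OF tens] hspan_0 bit_add_eq_0_iff)
qed (auto intro: hspan_0 hspan_add hspan_scal)

lemma tmult_even_part:
  assumes "v \<in> even2" "w \<in> all2"
  shows "v \<odot> even_part w = even_part (v \<odot> w)"
  using assms(1)
proof (induction rule: hspan2_homog_induct)
  case v: (tens p q d e)
  then have "d = e" by (simp add: bit_add_eq_0_iff)
  show ?case using assms(2)
  proof (induction rule: hspan2_induct)
    case w: (tens x y i j)
    show ?case
      using v w \<open>d = e\<close> by (simp add: even_part_tens tmult_tens_2 even_part_tens[OF homog_mult homog_mult])
  qed auto
qed auto

text \<open>
  Multiplication by an even tensor commutes with taking even parts, so the even part of an inverse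
  is again a right inverse, and hence is the inverse.
\<close>

lemma inverse_even:
  assumes "v \<in> even2" "w \<in> all2" "v \<odot> w = tens [1, 1]" "w \<odot> v = tens [1, 1]"
  shows "w \<in> even2"
proof -
  have one: "tens [1, 1] \<odot> z = z" "z \<odot> tens [1, 1] = z" if "z \<in> all2" for z
    using tmult_one[OF that] by (simp_all add: numeral_2_eq_2)
  have pw: "even_part w \<in> all2" using even_part_even2[OF assms(2)] even2_all2 by blast
  have "v \<odot> even_part w = tens [1, 1]"
    using tmult_even_part[OF assms(1,2)] assms(3) by (simp add: even_part_tens[OF homog_one homog_one])
  then have "w = w \<odot> (v \<odot> even_part w)" using one[OF assms(2)] by simp
  also have "\<dots> = w \<odot> v \<odot> even_part w"
    using assms pw even2_all2 by (intro tmult_assoc[symmetric]) auto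
  also have "\<dots> = even_part w" using assms(4) one[OF pw] by simp
  finally show ?thesis using even_part_even2[OF assms(2)] by simp
qed

end

section \<open>Antipode, counit and twistors\<close>

context quasi_hopf_superalgebra begin

notation tmult (infixl \<open>\<odot>\<close> 70)
notation tconc (infixr \<open>\<oslash>\<close> 75)

abbreviation S where "S \<equiv> antipode H"
abbreviation Sinv where "Sinv \<equiv> inv (antipode H)"

lemma Sinv_S [simp]: "Sinv (S x) = x" and S_Sinv [simp]: "S (Sinv x) = x"
  using antipode_bij by (simp_all add: bij_def surj_f_inv_f)

lemma S_inject [simp]: "S x = S y \<longleftrightarrow> x = y"
  using antipode_bij by (simp add: bij_def inj_eq)

lemma Sinv_eqI: "S y = x \<Longrightarrow> Sinv x = y" by auto

lemma Sinv_add [simp]: "Sinv (x + y) = Sinv x + Sinv y"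
  by (rule Sinv_eqI) (simp add: antipode_add)

lemma Sinv_scal [simp]: "Sinv (scal H c x) = scal H c (Sinv x)"
  by (rule Sinv_eqI) (simp add: antipode_scal)

lemma S_zero [simp]: "S 0 = 0" using antipode_add[of 0 0] by simp

lemma Sinv_zero [simp]: "Sinv 0 = 0" using Sinv_add[of 0 0] by simp

text \<open>
  The antipode preserves degrees and is injective, so a component of \<open>Sinv x\<close> of the wrong degree
  would be mapped to a nonzero component of \<open>x\<close> of the wrong degree.
\<close>

lemma Sinv_homog:
  assumes "x \<in> homog H i" shows "Sinv x \<in> homog H i"
proof -
  let ?y = "\<lambda>j. component H j (Sinv x)"
  have "S (?y (i + 1)) + S (?y i) = x"
    using component_sum[of "Sinv x"] by (cases i) (simp_all flip: antipode_add add: add.commute)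
  then have "S (?y (i + 1)) = x - S (?y i)" by (simp only: eq_diff_eq)
  then have "S (?y (i + 1)) \<in> homog H i"
    using homog_diff[OF assms antipode_grading[OF component_homog]] by simp
  then have "S (?y (i + 1)) = 0"
    using homog_both antipode_grading[OF component_homog] by blast
  then have "?y (i + 1) = 0" using S_inject[of "?y (i + 1)" 0] by simp
  then have "Sinv x = ?y i" using component_sum[of "Sinv x"] by (cases i) auto
  then show ?thesis by (metis component_homog)
qed

lemma Sinv_mult:
  assumes "x \<in> homog H i" "y \<in> homog H j"
  shows "Sinv (x * y) = scal H (koszul i j) (Sinv y * Sinv x)"
proof (rule Sinv_eqI)
  show "S (scal H (koszul i j) (Sinv y * Sinv x)) = x * y"
    using antipode_mult[OF Sinv_homog[OF assms(2)] Sinv_homog[OF assms(1)]]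
    by (simp add: antipode_scal koszul_commute[of j i] koszul_square)
qed

lemma counit_zero [simp]: "counit H 0 = 0" using counit_scal[of 0 0] by simp

lemma one_not_zero: "(1 :: 'a) \<noteq> 0"
  using counit_one by (metis counit_zero zero_neq_one)

lemma counit_odd_zero: "x \<in> homog H i \<Longrightarrow> counit H x \<noteq> 0 \<Longrightarrow> i = 0"
  using counit_grading by (cases i) auto

text \<open>
  Applying the counit to \<open>\<Sum> x \<beta> S(y) \<alpha> z = 1\<close>, where the sum runs over the inverse associator,
  shows that \<open>\<epsilon>(\<alpha>)\<close> and \<open>\<epsilon>(\<beta>)\<close> are nonzero, whereas the counit kills odd elements.
\<close>

lemma alpha_beta_even: "alpha H \<in> homog H 0" "beta H \<in> homog H 0"
proof -
  have sum: "counit H (\<Sum>x\<in>I. f x) = (\<Sum>x\<in>I. counit H (f x))" for I and f :: "'c \<Rightarrow> 'a"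
    by (induction I rule: infinite_finite_induct) (auto simp: counit_add)
  have "counit H (alpha H) * counit H (beta H) \<noteq> 0"
  proof
    assume zero: "counit H (alpha H) * counit H (beta H) = 0"
    have "counit H (tensor_eval3 H (\<lambda>x y z. x * beta H * S y * alpha H * z)
         (tensor_inverse H 3 (assoc H))) = 0"
      unfolding tensor_eval3_def lin_ext_def sum counit_scal
      using zero by (intro sum.neutral) (auto split: list.split simp: counit_mult)
    then show False using antipode_assoc_inverse counit_one by simp
  qed
  then show "alpha H \<in> homog H 0" "beta H \<in> homog H 0"
    using alpha_homog beta_homog counit_odd_zero by fastforce+
qed

text \<open>
  Evaluated on \<open>F\<inverse>\<close> and on \<open>F\<close>, these two contractions give the elements \<open>\<alpha>\<close> and \<open>\<beta>\<close> of the
  twisted algebra; evaluated on \<open>\<Delta>(x)\<close>, they give multiples of \<open>\<alpha>\<close> and \<open>\<beta>\<close> by \<open>\<epsilon>(x)\<close>.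
\<close>

definition alpha_eval where
  "alpha_eval a = lin_ext (scal H) (\<lambda>xs. case xs of [p, q] \<Rightarrow> S p * a * q | _ \<Rightarrow> 0)"
definition beta_eval where
  "beta_eval b = lin_ext (scal H) (\<lambda>xs. case xs of [p, q] \<Rightarrow> p * b * S q | _ \<Rightarrow> 0)"

lemma alpha_beta_eval_linear [simp]:
  "alpha_eval a (v + w) = alpha_eval a v + alpha_eval a w"
    "alpha_eval a (free_scal c v) = scal H c (alpha_eval a v)"
    "alpha_eval a 0 = 0"
  "beta_eval a (v + w) = beta_eval a v + beta_eval a w"
    "beta_eval a (free_scal c v) = scal H c (beta_eval a v)"
    "beta_eval a 0 = 0"
  by (simp_all add: alpha_eval_def beta_eval_def)

lemma multilinear_alpha_beta_eval:
  "multilinear (scal H) (scal H) (\<lambda>xs. case xs of [p, q] \<Rightarrow> S p * a * q | _ \<Rightarrow> 0)"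
  "multilinear (scal H) (scal H) (\<lambda>xs. case xs of [p, q] \<Rightarrow> p * b * S q | _ \<Rightarrow> 0)"
  by (intro multilinear_pair; simp add: antipode_add antipode_scal ring_distribs scal_mult_left scal_mult_right)+

lemma alpha_beta_eval_tens [simp]: "alpha_eval a (tens [p, q]) = S p * a * q" "beta_eval b (tens [p, q]) = p * b * S q"
  by (simp_all add: alpha_eval_def beta_eval_def lin_ext_tens[OF vector_space_axioms] multilinear_alpha_beta_eval)

lemma tensor_eval2_alpha_beta:
  "tensor_eval2 H (\<lambda>x y. S x * a * y) X = alpha_eval a (vec X)"
  "tensor_eval2 H (\<lambda>x y. x * b * S y) X = beta_eval b (vec X)"
  by (simp_all add: tensor_eval2_def alpha_eval_def beta_eval_def lin_ext_rep[OF vector_space_axioms] multilinear_alpha_beta_eval)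

definition id_counit where
  "id_counit = lin_ext (scal H) (\<lambda>xs. case xs of [x, y] \<Rightarrow> scal H (counit H y) x | _ \<Rightarrow> 0)"
definition counit_id where
  "counit_id = lin_ext (scal H) (\<lambda>xs. case xs of [x, y] \<Rightarrow> scal H (counit H x) y | _ \<Rightarrow> 0)"

lemma counit_id_linear [simp]:
  "id_counit (v + w) = id_counit v + id_counit w"
    "id_counit (free_scal c v) = scal H c (id_counit v)"
    "id_counit 0 = 0"
  "counit_id (v + w) = counit_id v + counit_id w"
    "counit_id (free_scal c v) = scal H c (counit_id v)"
    "counit_id 0 = 0"
  by (simp_all add: id_counit_def counit_id_def)

lemma counit_id_tens [simp]: "id_counit (tens [x, y]) = scal H (counit H y) x" "counit_id (tens [x, y]) = scal H (counit H x) y"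
  unfolding id_counit_def counit_id_def
  by (subst lin_ext_tens[OF vector_space_axioms];
      auto intro!: multilinear_pair simp: counit_add counit_scal scale_left_distrib scale_right_distrib mult.commute)+

text \<open>
  The Koszul sign of the product is invisible, since the counit vanishes on odd elements.
\<close>

lemma counit_id_mult:
  assumes "v \<in> all2" "w \<in> all2"
  shows "id_counit (v \<odot> w) = id_counit v * id_counit w" "counit_id (v \<odot> w) = counit_id v * counit_id w"
proof -
  have "id_counit (v \<odot> w) = id_counit v * id_counit w \<and> counit_id (v \<odot> w) = counit_id v * counit_id w"
    using assms(1)
  proof (induction rule: hspan2_induct)
    case v: (tens p q d e)
    show ?case using assms(2)
    proof (induction rule: hspan2_induct)
      case w: (tens x y i j)
      have q: "koszul e i * (counit H q * counit H y) = counit H q * counit H y"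
        using counit_grading[of q] v(2) by (cases e) auto
      have x: "koszul e i * (counit H p * counit H x) = counit H p * counit H x"
        using counit_grading[of x] w(1) by (cases i) auto
      show ?case
        by (simp add: tmult_tens_2[OF v w] counit_mult scal_mult_left scal_mult_right q x)
    qed (simp_all add: ring_distribs scal_mult_right)
  qed (simp_all add: ring_distribs scal_mult_left)
  then show "id_counit (v \<odot> w) = id_counit v * id_counit w" "counit_id (v \<odot> w) = counit_id v * counit_id w" by blast+
qed

lemma vec_counit_tensor: "vec (counit_tensor H a) = free_scal (counit H a) (tens [])"
  by (simp add: counit_tensor_def)

lemma multilinear_singleton:
  "multilinear (scal H) (scal H) (\<lambda>xs. case xs of [x] \<Rightarrow> x | _ \<Rightarrow> 0)"
  unfolding multilinear_def
proof (intro conjI allI, goal_cases)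
  case (1 xs ys a b)
  show ?case by (cases xs; cases ys) (auto split: list.split)
next
  case (2 xs ys c a)
  show ?case by (cases xs; cases ys) (auto split: list.split)
qed

lemma tens_1_inject:
  assumes "tens [x] = tens [y]"
  shows "x = y"
proof -
  have "lin_ext (scal H) (\<lambda>xs. case xs of [x] \<Rightarrow> x | _ \<Rightarrow> 0) (tens [z]) = z" for z
    by (simp add: lin_ext_tens[OF vector_space_axioms multilinear_singleton])
  then show ?thesis using assms by metis
qed

lemma tensor_linear_counit: "tensor_linear (\<lambda>x. vec (counit_tensor H x))"
  by (simp add: tensor_linear_def vec_counit_tensor counit_add counit_scal free.scale_left_distrib)

lemma tensor_linear_coprod: "tensor_linear (\<lambda>x. vec (coprod H x))"
  by (simp add: tensor_linear_def coprod_add coprod_scal)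

lemma vec_tensor_map_counit:
  assumes "vec F \<in> all2"
  shows "vec (tensor_map H [single_factor H, counit_tensor H] F) = tens [id_counit (vec F)]"
    "vec (tensor_map H [counit_tensor H, single_factor H] F) = tens [counit_id (vec F)]"
proof -
  note lin = tensor_linear_tens[unfolded tensor_linear_def]
  have "tmap (\<lambda>x. tens [x]) (\<lambda>x. vec (counit_tensor H x)) v = tens [id_counit v] \<and>
      tmap (\<lambda>x. vec (counit_tensor H x)) (\<lambda>x. tens [x]) v = tens [counit_id v]" if "v \<in> all2" for v
    using that
  proof (induction rule: hspan2_induct)
    case (tens x y i j)
    show ?case
      unfolding tmap_tens[OF tensor_linear_tens tensor_linear_counit]
        tmap_tens[OF tensor_linear_counit tensor_linear_tens]
      by (simp add: vec_counit_tensor lin)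
  qed (simp_all add: lin tens_zero)
  then show "vec (tensor_map H [single_factor H, counit_tensor H] F) = tens [id_counit (vec F)]"
    "vec (tensor_map H [counit_tensor H, single_factor H] F) = tens [counit_id (vec F)]"
    using assms by (simp_all add: vec_tensor_map tensor_linear_tens tensor_linear_counit)
qed

text \<open>
  A twistor is even: its image under \<open>1 \<otimes> \<epsilon>\<close> has the same degree as the twistor itself and equals 1.
  The remaining statements transfer evenness and the counit conditions to the inverse.
\<close>

lemma twistor_props:
  assumes "twistor H F"
  defines "f \<equiv> vec F" and "f' \<equiv> vec (tensor_inverse H 2 F)"
  shows "f \<in> even2" "f' \<in> even2" "f \<odot> f' = tens [1, 1]" "f' \<odot> f = tens [1, 1]"
    "id_counit f = 1" "counit_id f = 1" "id_counit f' = 1" "counit_id f' = 1"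
proof -
  have inv: "tensor_invertible H 2 F" and
    counits: "tensor_map H [counit_tensor H, single_factor H] F = single_factor H 1"
    "tensor_map H [single_factor H, counit_tensor H] F = single_factor H 1"
    using assms(1) unfolding twistor_def by auto
  obtain i where "F \<in> tensor_homog H 2 i" using assms(1) unfolding twistor_def by auto
  then have homog: "f \<in> hspan (\<lambda>ds. length ds = 2 \<and> sum_list ds = i)"
    unfolding f_def by (rule vec_tensor_homog)
  then have f: "f \<in> all2" by (rule subsetD[OF hspan_mono, rotated]) simp
  have f': "f' \<in> all2" and ff': "f \<odot> f' = tens [1, 1]" and f'f: "f' \<odot> f = tens [1, 1]"
    using vec_tensor_inverse[OF inv] unfolding f_def f'_def by (simp_all add: numeral_2_eq_2)
  have c: "id_counit f = 1" "counit_id f = 1"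
    using vec_tensor_map_counit[OF f[unfolded f_def]] unfolding counits f_def vec_single_factor
    by (metis tens_1_inject)+
  \<comment> \<open>Only terms with an even second factor survive, so the first factor carries the degree of \<open>F\<close>.\<close>
  have "id_counit f \<in> homog H i"
    using homog
  proof (induction rule: hspan2_homog_induct)
    case (tens x y j k)
    then show ?case
      using counit_odd_zero[OF tens(2)] by (cases "counit H y = 0") (auto intro: homog_scal)
  qed auto
  then have "1 \<in> homog H i" using c(1) by simp
  then have i: "i = 0"
    using homog_both[OF homog_one] one_not_zero by (cases i) auto
  show even: "f \<in> even2" using homog i by simp
  show "f' \<in> even2" using inverse_even[OF even f' ff' f'f] .
  have "id_counit (f \<odot> f') = 1" "counit_id (f \<odot> f') = 1" unfolding ff' by (simp_all add: counit_one)
  then show "id_counit f' = 1" "counit_id f' = 1" using counit_id_mult[OF f f'] c by simp_all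
  show "f \<odot> f' = tens [1, 1]" "f' \<odot> f = tens [1, 1]" "id_counit f = 1" "counit_id f = 1"
    by (fact ff' f'f c)+
qed

end

section \<open>Trace forms and their behaviour under twisting\<close>

text \<open>
  The module enters only through the linear form given by its supertrace, so that form is abstract here.
\<close>

locale trace_type = quasi_hopf_superalgebra H + graded_trace H \<tau>
  for H :: "('k::field, 'a::ring_1, 'z) quasi_hopf_scheme" (structure) and \<tau> :: "'a \<Rightarrow> 'k" +
  fixes u :: 'a
  assumes trace_type_element: "trace_type_element H u"

context trace_type begin

notation tmult (infixl \<open>\<odot>\<close> 70)
notation tconc (infixr \<open>\<oslash>\<close> 75)

abbreviation uinv where "uinv \<equiv> ring_inverse u"

lemma u_even: "u \<in> homog H 0" using trace_type_element unfolding trace_type_element_def by blast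

lemma u_inverse: "u * uinv = 1" "uinv * u = 1"
proof -
  obtain v where v: "u * v = 1" "v * u = 1"
    using trace_type_element unfolding trace_type_element_def by blast
  have "uinv = v"
    unfolding ring_inverse_def
  proof (rule the_equality)
    fix y assume y: "u * y = 1 \<and> y * u = 1"
    have "y = y * (u * v)" using v by simp
    also have "\<dots> = v" using y by (simp flip: mult.assoc)
    finally show "y = v" .
  qed (use v in blast)
  then show "u * uinv = 1" "uinv * u = 1" using v by simp_all
qed

lemma S_S: "S (S x) = u * x * uinv"
  using trace_type_element unfolding trace_type_element_def by blast

text \<open>
  This and the next lemma restate the trace type condition as it is used: a factor that a cyclic
  permutation brings to the other side of \<open>u\<close> (or of its inverse) changes by \<open>S\<^sup>2\<close>.
\<close>

lemma S_u: "S q * u = u * Sinv q"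
  using S_S[of "Sinv q"] by (simp add: mult.assoc u_inverse)

lemma uinv_S_S: "uinv * S (S q) = q * uinv"
  by (simp add: S_S u_inverse flip: mult.assoc)

text \<open>
  The inverse of an even element is even: the odd component of \<open>uinv\<close> is annihilated by \<open>u\<close>.
\<close>

lemma uinv_even: "uinv \<in> homog H 0"
proof -
  let ?a = "component H 0 uinv" let ?b = "component H 1 uinv"
  have sum: "u * ?a + u * ?b = 1" using component_sum[of uinv] u_inverse by (simp flip: distrib_left)
  have "u * ?b \<in> homog H 1" using homog_mult[OF u_even component_homog[of 1 uinv]] by simp
  moreover have "u * ?a \<in> homog H 0" using homog_mult[OF u_even component_homog[of 0 uinv]] by simp
  then have "1 - u * ?a \<in> homog H 0" using homog_one by auto
  moreover have "u * ?b = 1 - u * ?a" using sum by (simp add: eq_diff_eq add.commute)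
  ultimately have "u * ?b = 0" using homog_both[of "u * ?b" 0] by simp
  then have "uinv * (u * ?b) = 0" by simp
  then have "?b = 0" by (simp add: u_inverse flip: mult.assoc)
  then have "uinv = ?a" using component_sum[of uinv] by simp
  then show ?thesis by (metis component_homog)
qed

lemma trace_zero [simp]: "\<tau> 0 = 0"
  using trace_scal[of 0 0] by simp

text \<open>
  Signs that involve the degree of the argument of the trace may be dropped: the trace vanishes on
  odd elements.
\<close>

lemma trace_koszul:
  assumes "x \<in> homog H i"
  shows "koszul i k * \<tau> x = \<tau> x"
  using trace_odd[of x] assms by (cases i) auto

text \<open>
  The linear maps that define the two central elements, with \<open>\<alpha>\<close> and \<open>\<beta>\<close> replaced by arbitrary
  elements \<open>a\<close> and \<open>b\<close>.  Keeping these as parameters makes it possible to pass from the twisted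
  \<open>\<alpha>\<close>, \<open>\<beta>\<close> to the original ones separately.
\<close>

definition trace_form where
  "trace_form a b = lin_ext (scal H) (\<lambda>xs. case xs of [x, y, z] \<Rightarrow>
     scal H (\<tau> (u * Sinv a * y * b * S z)) x | _ \<Rightarrow> 0)"

definition trace_form_bar where
  "trace_form_bar a b = lin_ext (scal H) (\<lambda>xs. case xs of [x, y, z] \<Rightarrow>
     scal H (\<tau> (uinv * S b * S x * a * y)) z | _ \<Rightarrow> 0)"

lemma trace_form_linear [simp]:
  "trace_form a b (v + v') = trace_form a b v + trace_form a b v'"
    "trace_form a b (free_scal c v) = scal H c (trace_form a b v)"
    "trace_form a b 0 = 0"
  "trace_form_bar a b (v + v') = trace_form_bar a b v + trace_form_bar a b v'"
    "trace_form_bar a b (free_scal c v) = scal H c (trace_form_bar a b v)"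
    "trace_form_bar a b 0 = 0"
  by (simp_all add: trace_form_def trace_form_bar_def)

lemma multilinear_trace_form:
  "multilinear (scal H) (scal H) (\<lambda>xs. case xs of [x, y, z] \<Rightarrow>
     scal H (\<tau> (u * Sinv a * y * b * S z)) x | _ \<Rightarrow> 0)"
  "multilinear (scal H) (scal H) (\<lambda>xs. case xs of [x, y, z] \<Rightarrow>
     scal H (\<tau> (uinv * S b * S x * a * y)) z | _ \<Rightarrow> 0)"
  by (rule multilinear_triple;
      simp add: antipode_add antipode_scal ring_distribs scal_mult_left scal_mult_right
        scale_left_distrib scale_right_distrib mult.commute)+

lemma trace_form_tens [simp]:
  "trace_form a b (tens [x, y, z]) = scal H (\<tau> (u * Sinv a * y * b * S z)) x"
  "trace_form_bar a b (tens [x, y, z]) = scal H (\<tau> (uinv * S b * S x * a * y)) z"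
  by (simp_all add: trace_form_def trace_form_bar_def lin_ext_tens[OF vector_space_axioms] multilinear_trace_form)

lemma tensor_eval3_trace_form:
  "tensor_eval3 H (\<lambda>x y z. scal H (\<tau> (u * Sinv a * y * b * S z)) x) X = trace_form a b (vec X)"
  "tensor_eval3 H (\<lambda>x y z. scal H (\<tau> (uinv * S b * S x * a * y)) z) X = trace_form_bar a b (vec X)"
  by (simp_all add: tensor_eval3_def trace_form_def trace_form_bar_def lin_ext_rep[OF vector_space_axioms] multilinear_trace_form)

text \<open>
  A pair \<open>p \<otimes> q\<close> multiplied from the left is absorbed into \<open>a\<close>.  The factor \<open>S(q)\<close> at the right end
  is moved cyclically to the front, passes \<open>u\<close> as \<open>S\<inverse>(q)\<close>, and then meets \<open>S\<inverse>(a) p\<close>, so that the three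
  form \<open>S\<inverse>(S(p) a q)\<close>.
\<close>

lemma trace_absorb_alpha:
  assumes a: "a \<in> homog H 0" and b: "b \<in> homog H 0"
    and p: "p \<in> homog H d" and q: "q \<in> homog H e" and y: "y \<in> homog H j" and z: "z \<in> homog H l"
  shows "koszul e j * \<tau> (u * Sinv a * (p * y) * b * S (q * z)) = \<tau> (u * Sinv (S p * a * q) * y * b * S z)"
proof -
  let ?Y = "u * Sinv a * p * y * b * S z"
  have "?Y \<in> homog H (0 + 0 + d + j + 0 + l)"
    by (intro homog_mult u_even Sinv_homog antipode_grading a b p y z)
  then have Y: "?Y \<in> homog H (d + j + l)" by simp
  have "Sinv (S p * a * q) = scal H (koszul d e) (Sinv q * Sinv (S p * a))"
    using Sinv_mult[OF homog_mult[OF antipode_grading[OF p] a] q] by simp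
  also have "Sinv (S p * a) = Sinv a * p"
    using Sinv_mult[OF antipode_grading[OF p] a] by simp
  finally have "\<tau> (u * Sinv (S p * a * q) * y * b * S z) = koszul d e * \<tau> (u * Sinv q * Sinv a * p * y * b * S z)"
    by (simp add: scal_mult_left scal_mult_right mult.assoc)
  also have "u * Sinv q * Sinv a * p * y * b * S z = S q * ?Y"
    by (simp add: S_u flip: mult.assoc)
  finally have right: "\<tau> (u * Sinv (S p * a * q) * y * b * S z) = koszul d e * \<tau> (S q * ?Y)" .
  have "u * Sinv a * (p * y) * b * S (q * z) = scal H (koszul e l) (?Y * S q)"
    using antipode_mult[OF q z] by (simp add: scal_mult_left scal_mult_right mult.assoc)
  then have "\<tau> (u * Sinv a * (p * y) * b * S (q * z)) = koszul e l * (koszul (d + j + l) e * \<tau> (S q * ?Y))"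
    using trace_cyclic[OF Y antipode_grading[OF q]] by simp
  then have "koszul e j * \<tau> (u * Sinv a * (p * y) * b * S (q * z)) =
      koszul e j * (koszul e l * koszul (d + j + l) e) * \<tau> (S q * ?Y)"
    by (simp only: mult.assoc)
  also have "koszul e j * (koszul e l * koszul (d + j + l) e) = (koszul d e :: 'k)"
    by (cases e; cases d; cases j; cases l) (auto simp: koszul_def)
  finally show ?thesis unfolding right .
qed

text \<open>
  A pair multiplied from the right is absorbed into \<open>b\<close> by the antimultiplicativity of the antipode
  alone.
\<close>

lemma trace_absorb_beta:
  assumes z: "z \<in> homog H l" and q: "q \<in> homog H e"
  shows "koszul l e * \<tau> (u * Sinv a * (y * p) * b * S (z * q)) = \<tau> (u * Sinv a * y * (p * b * S q) * S z)"
  using antipode_mult[OF z q]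
  by (simp add: scal_mult_left scal_mult_right mult.assoc) (metis koszul_square mult.assoc mult_1)

text \<open>
  For the second form the roles are exchanged: multiplication from the left is the case that needs
  no cyclic permutation.
\<close>

lemma trace_bar_absorb_alpha:
  assumes p: "p \<in> homog H d" and x: "x \<in> homog H i"
  shows "koszul d i * \<tau> (uinv * S b * S (p * x) * a * (q * y)) = \<tau> (uinv * S b * S x * (S p * a * q) * y)"
  using antipode_mult[OF p x]
  by (simp add: scal_mult_left scal_mult_right mult.assoc) (metis koszul_square mult.assoc mult_1)

text \<open>
  The factor \<open>q\<close> at the right end is moved cyclically to the front and passes the inverse of \<open>u\<close> as
  \<open>S(S(q))\<close>, which together with \<open>S(b) S(p)\<close> forms \<open>S(p b S(q))\<close>.
\<close>

lemma trace_bar_absorb_beta: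
  assumes a: "a \<in> homog H 0" and b: "b \<in> homog H 0"
    and p: "p \<in> homog H d" and q: "q \<in> homog H e" and x: "x \<in> homog H i" and y: "y \<in> homog H j"
  shows "koszul j d * \<tau> (uinv * S b * S (x * p) * a * (y * q)) =
    koszul (i + j) (d + e) * \<tau> (uinv * S (p * b * S q) * S x * a * y)"
proof -
  let ?Y = "uinv * S b * S p * S x * a * y"
  have "?Y \<in> homog H (0 + 0 + d + i + 0 + j)"
    by (intro homog_mult uinv_even antipode_grading a b p x y)
  then have Y: "?Y \<in> homog H (d + i + j)" by simp
  have "S (p * b * S q) = scal H (koszul d e) (S (S q) * S (p * b))"
    using antipode_mult[OF homog_mult[OF p b] antipode_grading[OF q]] by simp
  also have "S (p * b) = S b * S p"
    using antipode_mult[OF p b] by simp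
  finally have "\<tau> (uinv * S (p * b * S q) * S x * a * y) = koszul d e * \<tau> (uinv * S (S q) * S b * S p * S x * a * y)"
    by (simp add: scal_mult_left scal_mult_right mult.assoc)
  also have "uinv * S (S q) * S b * S p * S x * a * y = q * ?Y"
    by (simp add: uinv_S_S mult.assoc[symmetric])
  finally have right: "\<tau> (uinv * S (p * b * S q) * S x * a * y) = koszul d e * \<tau> (q * ?Y)" .
  have "uinv * S b * S (x * p) * a * (y * q) = scal H (koszul i d) (?Y * q)"
    using antipode_mult[OF x p] by (simp add: scal_mult_left scal_mult_right mult.assoc)
  then have "\<tau> (uinv * S b * S (x * p) * a * (y * q)) = koszul i d * (koszul (d + i + j) e * \<tau> (q * ?Y))"
    using trace_cyclic[OF Y q] by simp
  then have "koszul j d * \<tau> (uinv * S b * S (x * p) * a * (y * q)) =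
      koszul j d * (koszul i d * koszul (d + i + j) e) * \<tau> (q * ?Y)"
    by (simp only: mult.assoc)
  also have "koszul j d * (koszul i d * koszul (d + i + j) e) = (koszul (i + j) (d + e) * koszul d e :: 'k)"
    by (cases e; cases d; cases i; cases j) (auto simp: koszul_def)
  finally show ?thesis unfolding right by (simp only: mult.assoc)
qed

abbreviation homog2 where "homog2 k \<equiv> hspan (\<lambda>ds. length ds = 2 \<and> sum_list ds = k)"

text \<open>
  The absorption rules for tensors of the form \<open>s \<otimes> D\<close>, and \<open>D \<otimes> s\<close> for the second form, where \<open>D\<close> is
  homogeneous.  The degrees of the individual terms of \<open>D\<close> enter the signs only through their sum,
  which is why the sums over the terms of \<open>D\<close> can be carried out.
\<close>

lemma trace_form_mult_left:
  assumes a: "a \<in> homog H 0" and b: "b \<in> homog H 0" and D: "D \<in> homog2 k" and s: "s \<in> homog H m"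
    and xyz: "x \<in> homog H i" "y \<in> homog H j" "z \<in> homog H l"
  shows "trace_form a b ((tens [s] \<oslash> D) \<odot> tens [x, y, z]) =
    scal H (koszul k i * \<tau> (u * Sinv (alpha_eval a D) * y * b * S z)) (s * x)"
  using D
proof (induction rule: hspan2_homog_induct)
  case (tens p q d e)
  have "koszul d i * (koszul e i * koszul e j) * \<tau> (u * Sinv a * (p * y) * b * S (q * z)) =
      koszul k i * \<tau> (u * Sinv (S p * a * q) * y * b * S z)"
    unfolding trace_absorb_alpha[OF a b tens(1,2) xyz(2,3), symmetric] tens(3)[symmetric] koszul_add_left
    by (simp add: ac_simps)
  then show ?case
    by (simp add: tmult_tens_3[OF s tens(1,2) xyz])
qed (simp_all add: ring_distribs scale_left_distrib scal_mult_left scal_mult_right mult.left_commute)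

lemma trace_form_mult_right:
  assumes D: "D \<in> homog2 k" and s: "s \<in> homog H m"
    and xyz: "x \<in> homog H i" "y \<in> homog H j" "z \<in> homog H l"
  shows "trace_form a b (tens [x, y, z] \<odot> (tens [s] \<oslash> D)) =
    scal H (koszul (j + l) m * koszul l k * \<tau> (u * Sinv a * y * beta_eval b D * S z)) (x * s)"
  using D
proof (induction rule: hspan2_homog_induct)
  case (tens p q d e)
  have "koszul j m * (koszul l m * koszul l d) * \<tau> (u * Sinv a * (y * p) * b * S (z * q)) =
      koszul (j + l) m * koszul l k * \<tau> (u * Sinv a * y * (p * b * S q) * S z)"
    unfolding trace_absorb_beta[OF xyz(3) tens(2), symmetric] tens(3)[symmetric] koszul_add_left koszul_add_right
    using koszul_square[of l e, where ?'a = 'k] by (simp add: ac_simps)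
  then show ?case
    by (simp add: tmult_tens_3[OF xyz s tens(1,2)])
qed (simp_all add: ring_distribs scale_left_distrib scal_mult_left scal_mult_right mult.left_commute)

lemma trace_form_bar_mult_left:
  assumes D: "D \<in> homog2 k" and s: "s \<in> homog H m"
    and xyz: "x \<in> homog H i" "y \<in> homog H j" "z \<in> homog H l"
  shows "trace_form_bar a b ((D \<oslash> tens [s]) \<odot> tens [x, y, z]) =
    scal H (koszul (i + j) m * koszul k i * \<tau> (uinv * S b * S x * alpha_eval a D * y)) (s * z)"
  using D
proof (induction rule: hspan2_homog_induct)
  case (tens p q d e)
  have "koszul e i * (koszul m i * koszul m j) * \<tau> (uinv * S b * S (p * x) * a * (q * y)) =
      koszul (i + j) m * koszul k i * \<tau> (uinv * S b * S x * (S p * a * q) * y)"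
    unfolding trace_bar_absorb_alpha[OF tens(1) xyz(1), symmetric] tens(3)[symmetric] koszul_add_left koszul_commute[of m]
    using koszul_square[of d i, where ?'a = 'k] by (simp add: ac_simps)
  then show ?case
    by (simp add: tmult_tens_3[OF tens(1,2) s xyz])
qed (simp_all add: ring_distribs scale_left_distrib scal_mult_left scal_mult_right mult.left_commute)

lemma trace_form_bar_mult_right:
  assumes a: "a \<in> homog H 0" and b: "b \<in> homog H 0" and D: "D \<in> homog2 k" and s: "s \<in> homog H m"
    and xyz: "x \<in> homog H i" "y \<in> homog H j" "z \<in> homog H l"
  shows "trace_form_bar a b (tens [x, y, z] \<odot> (D \<oslash> tens [s])) =
    scal H (koszul (i + j + l) k * \<tau> (uinv * S (beta_eval b D) * S x * a * y)) (z * s)"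
  using D
proof (induction rule: hspan2_homog_induct)
  case (tens p q d e)
  have "koszul j d * (koszul l d * koszul l e) * \<tau> (uinv * S b * S (x * p) * a * (y * q)) =
      koszul l (d + e) * (koszul j d * \<tau> (uinv * S b * S (x * p) * a * (y * q)))"
    by (simp add: koszul_add_right ac_simps)
  also have "\<dots> = koszul (i + j + l) k * \<tau> (uinv * S (p * b * S q) * S x * a * y)"
    unfolding trace_bar_absorb_beta[OF a b tens(1,2) xyz(1,2)] tens(3) koszul_add_left by (simp add: ac_simps)
  finally show ?case
    by (simp add: tmult_tens_3[OF xyz tens(1,2) s])
qed (simp_all add: ring_distribs scale_left_distrib scal_mult_left scal_mult_right mult.left_commute
      antipode_add antipode_scal)

text \<open>
  The case \<open>s = 1\<close> with \<open>D\<close> even: all signs are trivial.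
\<close>

lemma trace_form_twistor:
  assumes D: "D \<in> even2" and v: "v \<in> all3"
  shows "a \<in> homog H 0 \<Longrightarrow> b \<in> homog H 0 \<Longrightarrow> trace_form a b ((tens [1] \<oslash> D) \<odot> v) = trace_form (alpha_eval a D) b v"
    and "trace_form a b (v \<odot> (tens [1] \<oslash> D)) = trace_form a (beta_eval b D) v"
    and "trace_form_bar a b ((D \<oslash> tens [1]) \<odot> v) = trace_form_bar (alpha_eval a D) b v"
    and "a \<in> homog H 0 \<Longrightarrow> b \<in> homog H 0 \<Longrightarrow> trace_form_bar a b (v \<odot> (D \<oslash> tens [1])) = trace_form_bar a (beta_eval b D) v"
proof -
  show "trace_form a b ((tens [1] \<oslash> D) \<odot> v) = trace_form (alpha_eval a D) b v" if "a \<in> homog H 0" "b \<in> homog H 0"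
    using v
  proof (induction rule: hspan3_induct)
    case (tens x y z i j l)
    show ?case using trace_form_mult_left[OF that D homog_one tens] by simp
  qed simp_all
  show "trace_form a b (v \<odot> (tens [1] \<oslash> D)) = trace_form a (beta_eval b D) v"
    using v
  proof (induction rule: hspan3_induct)
    case (tens x y z i j l)
    show ?case using trace_form_mult_right[OF D homog_one tens] by simp
  qed simp_all
  show "trace_form_bar a b ((D \<oslash> tens [1]) \<odot> v) = trace_form_bar (alpha_eval a D) b v"
    using v
  proof (induction rule: hspan3_induct)
    case (tens x y z i j l)
    show ?case using trace_form_bar_mult_left[OF D homog_one tens] by simp
  qed simp_all
  show "trace_form_bar a b (v \<odot> (D \<oslash> tens [1])) = trace_form_bar a (beta_eval b D) v" if "a \<in> homog H 0" "b \<in> homog H 0"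
    using v
  proof (induction rule: hspan3_induct)
    case (tens x y z i j l)
    show ?case using trace_form_bar_mult_right[OF that D homog_one tens] by simp
  qed simp_all
qed

abbreviation coprod_vec where "coprod_vec x \<equiv> vec (coprod H x)"

lemma coprod_vec_homog: "x \<in> homog H k \<Longrightarrow> coprod_vec x \<in> homog2 k"
  by (intro vec_tensor_homog coprod_grading)

lemma eval_coproduct: "alpha_eval (alpha H) (coprod_vec x) = scal H (counit H x) (alpha H)"
  "beta_eval (beta H) (coprod_vec x) = scal H (counit H x) (beta H)"
  using antipode_alpha[of x] antipode_beta[of x] by (simp_all add: tensor_eval2_alpha_beta)

lemma counit_koszul: "x \<in> homog H k \<Longrightarrow> koszul k i * counit H x = counit H x"
  using counit_grading by (cases k) auto

abbreviation central where "central \<equiv> trace_form (alpha H) (beta H)"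
abbreviation central_bar where "central_bar \<equiv> trace_form_bar (alpha H) (beta H)"

text \<open>
  The case \<open>D = \<Delta>(x)\<close>: the contraction of \<open>\<Delta>(x)\<close> with \<open>\<alpha>\<close> or \<open>\<beta>\<close> is a multiple by \<open>\<epsilon>(x)\<close>.  The
  signs disappear because \<open>\<epsilon>\<close> vanishes for odd \<open>x\<close> and the trace vanishes on odd arguments.
\<close>

lemma trace_form_coprod:
  assumes x: "x \<in> homog H k" and s: "s \<in> homog H m" and v: "v \<in> all3"
  shows "central ((tens [s] \<oslash> coprod_vec x) \<odot> v) = scal H (counit H x) (s * central v)"
    and "central (v \<odot> (tens [s] \<oslash> coprod_vec x)) = scal H (counit H x) (central v * s)"
    and "central_bar ((coprod_vec x \<oslash> tens [s]) \<odot> v) = scal H (counit H x) (s * central_bar v)"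
    and "central_bar (v \<odot> (coprod_vec x \<oslash> tens [s])) = scal H (counit H x) (central_bar v * s)"
proof -
  note lin = ring_distribs scale_right_distrib scal_mult_left scal_mult_right mult.commute mult.left_commute
  have trace_C: "koszul (j + l) i * \<tau> (u * Sinv (alpha H) * y * beta H * S z) = \<tau> (u * Sinv (alpha H) * y * beta H * S z)"
    if "y \<in> homog H j" "z \<in> homog H l" for y z i j l
  proof (rule trace_koszul)
    have "u * Sinv (alpha H) * y * beta H * S z \<in> homog H (0 + 0 + j + 0 + l)"
      by (intro homog_mult u_even Sinv_homog antipode_grading alpha_beta_even that)
    then show "u * Sinv (alpha H) * y * beta H * S z \<in> homog H (j + l)" by simp
  qed
  have trace_C': "koszul (i + j) m * \<tau> (uinv * S (beta H) * S x * alpha H * y) = \<tau> (uinv * S (beta H) * S x * alpha H * y)"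
    if "x \<in> homog H i" "y \<in> homog H j" for x y i j m
  proof (rule trace_koszul)
    have "uinv * S (beta H) * S x * alpha H * y \<in> homog H (0 + 0 + i + 0 + j)"
      by (intro homog_mult uinv_even antipode_grading alpha_beta_even that)
    then show "uinv * S (beta H) * S x * alpha H * y \<in> homog H (i + j)" by simp
  qed
  show "central ((tens [s] \<oslash> coprod_vec x) \<odot> v) = scal H (counit H x) (s * central v)"
    using v
  proof (induction rule: hspan3_induct)
    case (tens a b c i j l)
    have "koszul k i * (counit H x * r) = counit H x * r" for r
      using counit_koszul[OF x] by (metis mult.assoc)
    then show ?case
      by (simp add: trace_form_mult_left[OF alpha_beta_even coprod_vec_homog[OF x] s tens] eval_coproduct scal_mult_left scal_mult_right)
  qed (simp_all add: ring_distribs scale_right_distrib scal_mult_right mult.commute)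
  show "central (v \<odot> (tens [s] \<oslash> coprod_vec x)) = scal H (counit H x) (central v * s)"
    using v
  proof (induction rule: hspan3_induct)
    case (tens a b c i j l)
    let ?t = "\<tau> (u * Sinv (alpha H) * b * beta H * S c)"
    have "koszul (j + l) m * koszul l k * (counit H x * ?t) = koszul k l * counit H x * (koszul (j + l) m * ?t)"
      by (simp add: koszul_commute[of l] ac_simps)
    also have "\<dots> = counit H x * ?t"
      unfolding trace_C[OF tens(2,3)] counit_koszul[OF x] ..
    finally show ?case
      by (simp add: trace_form_mult_right[OF coprod_vec_homog[OF x] s tens] eval_coproduct scal_mult_left scal_mult_right)
  qed (simp_all add: ring_distribs scale_right_distrib scal_mult_left mult.commute)
  show "central_bar ((coprod_vec x \<oslash> tens [s]) \<odot> v) = scal H (counit H x) (s * central_bar v)"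
    using v
  proof (induction rule: hspan3_induct)
    case (tens a b c i j l)
    let ?t = "\<tau> (uinv * S (beta H) * S a * alpha H * b)"
    have "koszul (i + j) m * koszul k i * (counit H x * ?t) = koszul k i * counit H x * (koszul (i + j) m * ?t)"
      by (simp add: ac_simps)
    also have "\<dots> = counit H x * ?t"
      unfolding trace_C'[OF tens(1,2)] counit_koszul[OF x] ..
    finally show ?case
      by (simp add: trace_form_bar_mult_left[OF coprod_vec_homog[OF x] s tens] eval_coproduct scal_mult_left scal_mult_right)
  qed (simp_all add: ring_distribs scale_right_distrib scal_mult_right mult.commute)
  show "central_bar (v \<odot> (coprod_vec x \<oslash> tens [s])) = scal H (counit H x) (central_bar v * s)"
    using v
  proof (induction rule: hspan3_induct)
    case (tens a b c i j l)
    have "koszul (i + j + l) k * (counit H x * r) = counit H x * r" for r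
      using counit_koszul[OF x] koszul_commute by (metis mult.assoc)
    then show ?case
      by (simp add: trace_form_bar_mult_right[OF alpha_beta_even coprod_vec_homog[OF x] s tens] eval_coproduct antipode_scal scal_mult_left scal_mult_right)
  qed (simp_all add: ring_distribs scale_right_distrib scal_mult_left mult.commute)
qed

abbreviation id_coprod where "id_coprod \<equiv> tmap (\<lambda>x. tens [x]) coprod_vec"
abbreviation coprod_id where "coprod_id \<equiv> tmap coprod_vec (\<lambda>x. tens [x])"

text \<open>
  By the preceding rule, multiplication by \<open>(1 \<otimes> \<Delta>)F\<close> acts on the value of the form as multiplication
  by \<open>(1 \<otimes> \<epsilon>)F\<close>, and likewise on the other side and for the second form.
\<close>

lemma trace_form_id_coprod:
  assumes f: "f \<in> all2" and v: "v \<in> all3"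
  shows "central (id_coprod f \<odot> v) = id_counit f * central v" "central (v \<odot> id_coprod f) = central v * id_counit f"
    "central_bar (coprod_id f \<odot> v) = counit_id f * central_bar v" "central_bar (v \<odot> coprod_id f) = central_bar v * counit_id f"
proof -
  have "central (id_coprod f \<odot> v) = id_counit f * central v \<and> central (v \<odot> id_coprod f) = central v * id_counit f \<and>
    central_bar (coprod_id f \<odot> v) = counit_id f * central_bar v \<and> central_bar (v \<odot> coprod_id f) = central_bar v * counit_id f"
    using f
  proof (induction rule: hspan2_induct)
    case (tens x y i j)
    show ?case
      by (simp add: tmap_tens tensor_linear_tens tensor_linear_coprod trace_form_coprod[OF tens(1,2) v]
        trace_form_coprod[OF tens(2,1) v] scal_mult_left scal_mult_right)
  qed (simp_all add: ring_distribs scal_mult_left scal_mult_right)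
  then show "central (id_coprod f \<odot> v) = id_counit f * central v" "central (v \<odot> id_coprod f) = central v * id_counit f"
    "central_bar (coprod_id f \<odot> v) = counit_id f * central_bar v" "central_bar (v \<odot> coprod_id f) = central_bar v * counit_id f" by blast+
qed

lemma conjugate_cancel:
  assumes "g \<in> all3" "g' \<in> all3" "g' \<odot> g = tens [1, 1, 1]" "p \<in> all3" "v \<in> all3" "q \<in> all3"
  shows "g' \<odot> ((g \<odot> p \<odot> v \<odot> q \<odot> g') \<odot> g) = p \<odot> v \<odot> q"
proof -
  have one: "tens [1, 1, 1] \<odot> z = z" "z \<odot> tens [1, 1, 1] = z" if "z \<in> all3" for z
    using tmult_one[OF that] by (simp_all add: numeral_3_eq_3)
  have "g' \<odot> ((g \<odot> p \<odot> v \<odot> q \<odot> g') \<odot> g) = g' \<odot> (g \<odot> p \<odot> v \<odot> q)"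
    using assms by (simp add: tmult_assoc[where n = 3] tmult_hspan one)
  also have "\<dots> = g' \<odot> (g \<odot> (p \<odot> v \<odot> q))"
    using assms by (simp add: tmult_assoc[where n = 3] tmult_hspan)
  also have "\<dots> = g' \<odot> g \<odot> (p \<odot> v \<odot> q)"
    using assms by (intro tmult_assoc[symmetric] tmult_hspan)
  also have "\<dots> = p \<odot> v \<odot> q"
    using assms by (simp add: tmult_hspan one)
  finally show ?thesis .
qed

text \<open>
  The twisted \<open>\<alpha>\<close> and \<open>\<beta>\<close> are traded for factors \<open>1 \<otimes> F\<inverse>\<close> on the left and \<open>1 \<otimes> F\<close> on the right,
  which cancel the outer factors of the twisted tensor.  The inner factors are then removed by
  \<open>trace_form_id_coprod\<close> and the counit conditions on the twistor.
\<close>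

lemma trace_form_twist:
  assumes F: "twistor H F" and \<theta>: "\<theta> \<in> tensor_power H 3"
  shows "trace_form (alpha (twist H F)) (beta (twist H F)) (vec (twist_tensor H F \<theta>)) = central (vec \<theta>)"
    and "trace_form_bar (alpha (twist H F)) (beta (twist H F)) (vec (twist_tensor_bar H F \<theta>)) = central_bar (vec \<theta>)"
proof -
  let ?f = "vec F" and ?f' = "vec (tensor_inverse H 2 F)" and ?t = "vec \<theta>"
  note F = twistor_props[OF F]
  have t: "?t \<in> all3" using vec_tensor_power[OF \<theta>] .
  have f: "?f \<in> all2" "?f' \<in> all2" using F(1,2) even2_all2 by blast+
  have coprod: "coprod_vec x \<in> all2" for x using vec_tensor_power[OF coprod_closed] .
  have ev: "alpha (twist H F) = alpha_eval (alpha H) ?f'" "beta (twist H F) = beta_eval (beta H) ?f"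
    by (simp_all add: twist_def Let_def tensor_eval2_alpha_beta)
  let ?G = "tens [1] \<oslash> ?f" and ?G' = "tens [1] \<oslash> ?f'"
  let ?D = "id_coprod ?f" and ?D' = "id_coprod ?f'"
  have mem: "?G \<in> all3" "?G' \<in> all3" "?D \<in> all3" "?D' \<in> all3"
    using f coprod by (auto intro: tens_1_tconc_all3 tmap_all3 tensor_linear_coprod)
  have inv: "?G' \<odot> ?G = tens [1, 1, 1]" by (simp add: tmult_tconc_one f F)
  let ?X = "?G \<odot> ?D \<odot> ?t \<odot> ?D' \<odot> ?G'"
  have X: "vec (twist_tensor H F \<theta>) = ?X"
    by (simp add: twist_tensor_def Let_def vec_tensor_map tensor_linear_tens tensor_linear_coprod)
  have Xin: "?X \<in> all3" "?X \<odot> ?G \<in> all3" "?D \<odot> ?t \<in> all3" by (intro tmult_hspan mem t)+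
  have "trace_form (alpha_eval (alpha H) ?f') (beta_eval (beta H) ?f) ?X = central (?G' \<odot> (?X \<odot> ?G))"
    by (simp only: trace_form_twistor(1)[OF F(2) Xin(2) alpha_beta_even] trace_form_twistor(2)[OF F(1) Xin(1)])
  also have "\<dots> = central (?D \<odot> ?t \<odot> ?D')"
    by (simp only: conjugate_cancel[OF mem(1,2) inv mem(3) t mem(4)])
  also have "\<dots> = central ?t"
    by (simp add: trace_form_id_coprod f Xin t F)
  finally show "trace_form (alpha (twist H F)) (beta (twist H F)) (vec (twist_tensor H F \<theta>)) = central (vec \<theta>)"
    unfolding X ev .
  let ?G = "?f \<oslash> tens [1]" and ?G' = "?f' \<oslash> tens [1]"
  let ?D = "coprod_id ?f" and ?D' = "coprod_id ?f'"
  have mem: "?G \<in> all3" "?G' \<in> all3" "?D \<in> all3" "?D' \<in> all3"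
    using f coprod by (auto intro: tens_1_tconc_all3 tmap_all3 tensor_linear_coprod)
  have inv: "?G' \<odot> ?G = tens [1, 1, 1]" by (simp add: tmult_tconc_one f F)
  let ?X = "?G \<odot> ?D \<odot> ?t \<odot> ?D' \<odot> ?G'"
  have X: "vec (twist_tensor_bar H F \<theta>) = ?X"
    by (simp add: twist_tensor_bar_def Let_def vec_tensor_map tensor_linear_tens tensor_linear_coprod)
  have Xin: "?X \<in> all3" "?X \<odot> ?G \<in> all3" "?G' \<odot> ?X \<in> all3" "?D \<odot> ?t \<in> all3" by (intro tmult_hspan mem t)+
  have "trace_form_bar (alpha_eval (alpha H) ?f') (beta_eval (beta H) ?f) ?X = central_bar (?G' \<odot> ?X \<odot> ?G)"
    by (simp only: trace_form_twistor(4)[OF F(1) Xin(3) alpha_beta_even] trace_form_twistor(3)[OF F(2) Xin(1)])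
  also have "?G' \<odot> ?X \<odot> ?G = ?G' \<odot> (?X \<odot> ?G)"
    by (rule tmult_assoc[OF mem(2) Xin(1) mem(1)])
  also have "central_bar \<dots> = central_bar (?D \<odot> ?t \<odot> ?D')"
    by (simp only: conjugate_cancel[OF mem(1,2) inv mem(3) t mem(4)])
  also have "\<dots> = central_bar ?t"
    by (simp add: trace_form_id_coprod f Xin t F)
  finally show "trace_form_bar (alpha (twist H F)) (beta (twist H F)) (vec (twist_tensor_bar H F \<theta>)) = central_bar (vec \<theta>)"
    unfolding X ev .
qed

end

theorem theorem5:
  fixes H :: "('k::field, 'a::ring_1) quasi_hopf"
    and V :: "('k, 'v::ab_group_add, 'a) super_module"
    and u :: 'a
    and F \<theta> \<theta>' :: "('k, 'a) tensor"
  assumes "quasi_hopf_superalgebra H"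
    and "trace_type_element H u"
    and "graded_module H V"
    and "finite_dim V"
    and "twistor H F"
    and "\<theta> \<in> tensor_power H 3"
    and "\<And>a. tensor_map H [single_factor H, coprod H] (coprod H a) \<cdot>\<^bsub>H\<^esub> \<theta> =
           \<theta> \<cdot>\<^bsub>H\<^esub> tensor_map H [single_factor H, coprod H] (coprod H a)"
    and "\<theta>' \<in> tensor_power H 3"
    and "\<And>a. \<theta>' \<cdot>\<^bsub>H\<^esub> tensor_map H [coprod H, single_factor H] (coprod H a) =
           tensor_map H [coprod H, single_factor H] (coprod H a) \<cdot>\<^bsub>H\<^esub> \<theta>'"
  shows "trace_elt (twist H F) V u (twist_tensor H F \<theta>) = trace_elt H V u \<theta> \<and>
         trace_elt_bar (twist H F) V u (twist_tensor_bar H F \<theta>') = trace_elt_bar H V u \<theta>'"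
proof -
  interpret quasi_hopf_superalgebra H by fact
  interpret graded_trace H "\<lambda>a. supertrace V (act V a)"
    by (rule graded_module.graded_trace_supertrace) fact+
  interpret trace_type H "\<lambda>a. supertrace V (act V a)" u
    by unfold_locales fact
  have twist: "tensor_eval3 (twist H F) = tensor_eval3 H" "antipode (twist H F) = S"
    "scal (twist H F) = scal H"
    by (simp_all add: tensor_eval3_def[abs_def] twist_def Let_def)
  have "trace_elt H V u X = trace_form (alpha H) (beta H) (vec X)"
    "trace_elt (twist H F) V u X = trace_form (alpha (twist H F)) (beta (twist H F)) (vec X)"
    "trace_elt_bar H V u X = trace_form_bar (alpha H) (beta H) (vec X)"
    "trace_elt_bar (twist H F) V u X = trace_form_bar (alpha (twist H F)) (beta (twist H F)) (vec X)" for X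
    unfolding trace_elt_def trace_elt_bar_def twist by (simp_all only: tensor_eval3_trace_form)
  then show ?thesis
    using trace_form_twist[OF assms(5)] assms(6,8) by simp
qed

end
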